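(* (Collapsing) Let $\Gamma$ be a $\Sigma(\Omega)$-sequent, let $\alpha\in\vartheta(\varepsilon_{\Omega+1})$ and $X\subseteq\vartheta(\varepsilon_{\Omega+1})$ satisfy $\alpha\in\mathcal H_\alpha(X)$ and $X\subseteq\bigcap\{C_\xi(\vartheta\xi)\mid\alpha\prec\xi\}$. If $\mathcal H_\alpha[X]\vdash^\beta_{\Omega+1}\Gamma$, then $\mathcal H_\eta[X]\vdash^{\vartheta\eta}_{\vartheta\eta}\Gamma$ for $\eta=\alpha+\omega(\beta)$.
   Context: Ordinal terms: The set $\vartheta(\varepsilon_{\Omega+1})$ of terms, a relation $\prec$ and finite sets $E(\alpha)$ are defined by simultaneous recursion on term length: Terms: $\Omega$; $\vartheta\alpha$ for each term $\alpha$; $\langle\alpha_0,\dots,\alpha_{n-1}\rangle$ ($n\ge0$) provided that if $n>1$ then $\alpha_{n-1}\preceq\dots\preceq\alpha_0$ ($\preceq$ is $\prec$ or syntactic equality), and if $n=1$ then $\alpha_0$ is not $\Omega$ or of the form $\vartheta\beta$. $E(\Omega)=\emptyset$, $E(\vartheta\alpha)=\{\vartheta\alpha\}$, $E(\langle\alpha_0,\dots\rangle)=\bigcup_iE(\alpha_i)$. $\alpha\prec\beta$ iff: (1) $\alpha=\Omega$, $\beta=\langle\beta_0,\dots,\beta_{n-1}\rangle$, $n>0$, $\Omega\preceq\beta_0$; or (2) $\alpha=\vartheta\alpha'$ and either $\beta=\Omega$, or $\beta=\langle\beta_0,\dots\rangle$ nonempty with $\alpha\preceq\beta_0$, or $\beta=\vartheta\beta'$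 with $\alpha'\prec\beta'$ and $\gamma\prec\beta$ for all $\gamma\in E(\alpha')$, or $\beta=\vartheta\beta'$ with $\alpha\preceq\gamma$ for some $\gamma\in E(\beta')$; or (3) $\alpha=\langle\alpha_0,\dots,\alpha_{m-1}\rangle$ and either $\beta\in\{\Omega\}\cup\{\vartheta\beta'\}$ with ($m=0$ or $\alpha_0\prec\beta$), or $\beta=\langle\beta_0,\dots,\beta_{n-1}\rangle$ is lexicographically larger ($\alpha$ a proper initial segment of $\beta$, or first difference $\alpha_j\prec\beta_j$). Numerals: $n:=\langle0,\dots,0\rangle$ ($n$ entries, $0=\langle\rangle$), $\omega:=\langle 1\rangle$. Addition: identify $\Omega,\vartheta\alpha$ with $\langle\Omega\rangle,\langle\vartheta\alpha\rangle$ and set $\langle\alpha_0,\dots,\alpha_{m-1}\rangle+\langle\beta_0,\dots,\beta_{n-1}\rangle=\langle\alpha_0,\dots,\alpha_{k-1},\beta_0,\dots,\beta_{n-1}\rangle$ where $k$ is largest such that $\beta_0\preceq\alpha_{k-1}$ (all of $\alpha$ if $n=0$; $k=0$ if no such); $\omega\cdot\Omega=\Omega$, $\omega\cdot\vartheta\alpha=\vartheta\alpha$, $\omega\cdot\langle\alpha_0,\dots\rangle=\langle1+\alpha_0,\dots\rangle$; $\omega(\alpha)=\alpha$ if $\alpha$ is $\Omega$ or of the form $\vartheta\alpha'$, and $\omega(\alpha)=\langle\alpha\rangle$ otherwise. Coefficient sets: $C_\alpha(\beta)$ is the least set containing $\Omega$ and all $\gamma\prec\beta$, containing $\vartheta\gamma$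 whenever it contains $\gamma$ with $\gamma\prec\alpha$, and containing every term $\langle\gamma_0,\dots,\gamma_{n-1}\rangle$ whose entries it contains. $\mathcal H_\alpha(Y)=\bigcap\{C_\gamma(\delta)\mid\alpha\prec\gamma,\ Y\subseteq C_\gamma(\delta)\}$ (all terms if there are no such $\gamma,\delta$); $\mathcal H_\alpha[X]$ is the operator $Y\mapsto\mathcal H_\alpha(X\cup Y)$. Language: formulas are in negation normal form. An operator form is a formula $\varphi(x,X)$ of arithmetic with an extra unary predicate $X$, with one free number variable and no subformula $\neg Xt$. $\mathcal L^\Omega_{\mathsf{ID}}$ extends $\mathcal L_{\mathsf{PA}}$ by predicates $I^{\prec\alpha}_\varphi$ for each operator form $\varphi$ and term $\alpha\preceq\Omega$; $\varphi(t,I^{\prec\gamma}_\varphi)$ replaces $x$ by $t$ and $Xs$ by $I^{\prec\gamma}_\varphi s$. A $\Sigma(\Omega)$-formula is one with no subformula of the form $\neg I^{\prec\Omega}_\varphi t$; a $\Sigma(\Omega)$-sequent is a finite set of $\Sigma(\Omega)$-sentences. Each sentence is assigned a disjunction or conjunction: a false $\mathcal L_{\mathsf{PA}}$-literal $\simeq$ empty disjunction; $I^{\prec\alpha}_\varphi t\simeq\bigvee_{\gamma\prec\alpha}\varphi(t,I^{\prec\gamma}_\varphi)$; $\psi_0\lor\psi_1\simeq\bigvee_{i\prec2}\psi_i$; $\exists x\,\psi(x)\simeq\bigvee_{n\prec\omega}\psi(n)$; and $\neg\psi\simeq\bigwedge_{\gamma\prec\alpha}\neg\psi_\gamma$ whenever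 $\psi\simeq\bigvee_{\gamma\prec\alpha}\psi_\gamma$. Ranks: $\operatorname{rk}=0$ for $\mathcal L_{\mathsf{PA}}$-literals, $\operatorname{rk}(\pm I^{\prec\alpha}_\varphi t)=\omega\cdot\alpha$, $\operatorname{rk}(\psi_0\lor\psi_1)=\operatorname{rk}(\psi_0\land\psi_1)=\max(\operatorname{rk}\psi_0,\operatorname{rk}\psi_1)+1$, $\operatorname{rk}(\exists x\psi)=\operatorname{rk}(\forall x\psi)=\operatorname{rk}(\psi)+1$. $k(\psi)$ is the set of $\alpha$ such that $\psi$ contains a literal $I^{\prec\alpha}_\varphi t$ or $\neg I^{\prec\alpha}_\varphi t$; $k(\Gamma)=\bigcup_{\psi\in\Gamma}k(\psi)$. Operators: a nice operator is $\mathcal H$ from subsets of terms to subsets of terms with $X\subseteq\mathcal H(X)$, ($X\subseteq\mathcal H(Y)\Rightarrow\mathcal H(X)\subseteq\mathcal H(Y)$), and ($\alpha\in\mathcal H(X)\Leftrightarrow E(\alpha)\subseteq\mathcal H(X)$); $\mathcal H[Z](X):=\mathcal H(Z\cup X)$. Derivations: $\mathcal H\vdash^\alpha_\rho\Gamma$ is defined by recursion on $\alpha$: it holds iff $\{\alpha\}\cup k(\Gamma)\subseteq\mathcal H(\emptyset)$ and one of: ($\bigwedge$) some $\psi\simeq\bigwedge_{\gamma\prec\delta}\psi_\gamma$ in $\Gamma$ such that for every $\gamma\prec\delta$ there is $\alpha(\gamma)\prec\alpha$ with $\mathcal H[\{\gamma\}]\vdash^{\alpha(\gamma)}_\rho\Gamma\cup\{\psi_\gamma\}$;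 ($\bigvee$) some $\psi\simeq\bigvee_{\gamma\prec\delta}\psi_\gamma$ in $\Gamma$, some $\gamma\prec\delta$ with $\gamma\prec\alpha$ and $\gamma\in\mathcal H(\emptyset)$, and $\alpha'\prec\alpha$ with $\mathcal H\vdash^{\alpha'}_\rho\Gamma\cup\{\psi_\gamma\}$; (Cut) some sentence $\psi$ with $\operatorname{rk}(\psi)\prec\rho$ and $\alpha'\prec\alpha$ with $\mathcal H\vdash^{\alpha'}_\rho\Gamma\cup\{\psi\}$ and $\mathcal H\vdash^{\alpha'}_\rho\Gamma\cup\{\neg\psi\}$; (Fix) $\Omega\preceq\alpha$, some $I^{\prec\Omega}_\varphi t\in\Gamma$ and $\alpha'\prec\alpha$ with $\mathcal H\vdash^{\alpha'}_\rho\Gamma\cup\{\varphi(t,I^{\prec\Omega}_\varphi)\}$. *)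

theory Defs
  imports Main
begin

section \<open>Ordinal terms\<close>

text \<open>
  The informal definition is a simultaneous recursion on term length.  Here the order and the
  sets of subterms are defined on all raw terms first; the side conditions on sequences then
  single out the genuine terms, which become the type \<open>oterm\<close>.
\<close>

datatype raw = ROm | RTh raw | RSeq "raw list"

fun raw_E :: "raw \<Rightarrow> raw set" where
  "raw_E ROm = {}"
| "raw_E (RTh a) = {RTh a}"
| "raw_E (RSeq as) = (\<Union>a\<in>set as. raw_E a)"

lemma raw_E_size: "c \<in> raw_E a \<Longrightarrow> size c \<le> size a"
proof (induction a rule: raw_E.induct)
  case (3 as)
  then obtain a where a: "a \<in> set as" "c \<in> raw_E a" by auto
  then have "size c \<le> size a" using 3 by blast
  also have "size a \<le> size_list size as" using a(1) by (simp add: size_list_estimation')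
  finally show ?case by simp
qed auto

lemma size_nth_raw: "j < length as \<Longrightarrow> size (as ! j) \<le> size_list size (as :: raw list)"
  by (rule size_list_estimation'[OF nth_mem]) auto

declare conj_cong [fundef_cong] disj_cong [fundef_cong]

function raw_less :: "raw \<Rightarrow> raw \<Rightarrow> bool" where
  "raw_less ROm ROm = False"
| "raw_less ROm (RTh b) = False"
| "raw_less ROm (RSeq bs) = (bs \<noteq> [] \<and> (ROm = bs ! 0 \<or> raw_less ROm (bs ! 0)))"
| "raw_less (RTh a) ROm = True"
| "raw_less (RTh a) (RSeq bs) =
     (bs \<noteq> [] \<and> (RTh a = bs ! 0 \<or> raw_less (RTh a) (bs ! 0)))"
| "raw_less (RTh a) (RTh b) =
     ((raw_less a b \<and> (\<forall>c\<in>raw_E a. raw_less c (RTh b))) \<or>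
      (\<exists>c\<in>raw_E b. RTh a = c \<or> raw_less (RTh a) c))"
| "raw_less (RSeq as) ROm = (as = [] \<or> raw_less (as ! 0) ROm)"
| "raw_less (RSeq as) (RTh b) = (as = [] \<or> raw_less (as ! 0) (RTh b))"
| "raw_less (RSeq as) (RSeq bs) =
     ((length as < length bs \<and> take (length as) bs = as) \<or>
      (\<exists>j\<in>{..<min (length as) (length bs)}.
         take j as = take j bs \<and> raw_less (as ! j) (bs ! j)))"
  by pat_completeness auto
termination
  by (relation "measure (\<lambda>(a, b). size a + size b)")
    (auto simp: less_Suc_eq_le size_nth_raw intro!: le_SucI[OF add_mono] dest!: raw_E_size)

fun raw_ok :: "raw \<Rightarrow> bool" where
  "raw_ok ROm = True"
| "raw_ok (RTh a) = raw_ok a"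
| "raw_ok (RSeq as) =
     ((\<forall>a\<in>set as. raw_ok a) \<and>
      (1 < length as \<longrightarrow>
        (\<forall>i. Suc i < length as \<longrightarrow> raw_less (as ! Suc i) (as ! i) \<or> as ! Suc i = as ! i)) \<and>
      (length as = 1 \<longrightarrow> as ! 0 \<noteq> ROm \<and> (\<forall>b. as ! 0 \<noteq> RTh b)))"

typedef oterm = "{t. raw_ok t}"
  morphisms raw_of to_term
  by (rule exI[of _ ROm]) simp

definition oless :: "oterm \<Rightarrow> oterm \<Rightarrow> bool" (infix "\<prec>" 50) where
  "s \<prec> t \<longleftrightarrow> raw_less (raw_of s) (raw_of t)"

definition oleq :: "oterm \<Rightarrow> oterm \<Rightarrow> bool" (infix "\<preceq>" 50) where
  "s \<preceq> t \<longleftrightarrow> s \<prec> t \<or> s = t"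

definition Om :: oterm where
  "Om = to_term ROm"

definition Th :: "oterm \<Rightarrow> oterm" where
  "Th a = to_term (RTh (raw_of a))"

definition is_seq :: "oterm list \<Rightarrow> bool" where
  "is_seq as \<longleftrightarrow>
     (1 < length as \<longrightarrow> (\<forall>i. Suc i < length as \<longrightarrow> as ! Suc i \<preceq> as ! i)) \<and>
     (length as = 1 \<longrightarrow> as ! 0 \<noteq> Om \<and> (\<forall>b. as ! 0 \<noteq> Th b))"

text \<open>\<open>Seq as\<close> is meaningful only if \<open>is_seq as\<close> holds.\<close>

definition Seq :: "oterm list \<Rightarrow> oterm" where
  "Seq as = to_term (RSeq (map raw_of as))"

definition E_set :: "oterm \<Rightarrow> oterm set" where
  "E_set a = to_term ` raw_E (raw_of a)"

text \<open>The following facts recover the informal description of terms, \<open>E_set\<close> and \<open>\<prec>\<close>.\<close>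

lemma raw_ok_raw_of [simp]: "raw_ok (raw_of a)"
  using raw_of by simp

lemma raw_of_Om [simp]: "raw_of Om = ROm"
  by (simp add: Om_def to_term_inverse)

lemma raw_of_Th [simp]: "raw_of (Th a) = RTh (raw_of a)"
  by (simp add: Th_def to_term_inverse)

lemma raw_of_eq_Om [simp]: "raw_of a = ROm \<longleftrightarrow> a = Om"
  by (metis raw_of_Om raw_of_inject)

lemma raw_of_eq_Th: "raw_of a = RTh b \<longleftrightarrow> (\<exists>b'. b = raw_of b' \<and> a = Th b')"
proof
  assume *: "raw_of a = RTh b"
  then have "raw_ok b" using raw_ok_raw_of[of a] by simp
  then have "b = raw_of (to_term b)" by (simp add: to_term_inverse)
  with * show "\<exists>b'. b = raw_of b' \<and> a = Th b'" by (metis raw_of_Th raw_of_inject)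
qed auto

lemma is_seq_iff: "is_seq as \<longleftrightarrow> raw_ok (RSeq (map raw_of as))"
  by (auto simp: is_seq_def oleq_def oless_def raw_of_inject raw_of_eq_Th)

lemma raw_of_Seq: "is_seq as \<Longrightarrow> raw_of (Seq as) = RSeq (map raw_of as)"
  unfolding Seq_def is_seq_iff by (simp add: to_term_inverse)

lemma oterm_cases [case_names Om Th Seq]:
  obtains "a = Om" | b where "a = Th b" | as where "is_seq as" "a = Seq as"
proof (cases "raw_of a")
  case ROm
  then show ?thesis using that by simp
next
  case (RTh b)
  then show ?thesis using that by (auto simp: raw_of_eq_Th)
next
  case (RSeq rs)
  have ok: "raw_ok (RSeq rs)" using raw_ok_raw_of[of a] RSeq by simp
  then have "map raw_of (map to_term rs) = rs"
    by (auto simp: to_term_inverse intro: map_idI)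
  with ok RSeq have "is_seq (map to_term rs)" "a = Seq (map to_term rs)"
    by (metis is_seq_iff, metis Seq_def raw_of_inverse)
  then show ?thesis using that by blast
qed

lemma oterm_distinct:
  "Om \<noteq> Th a" "is_seq as \<Longrightarrow> Om \<noteq> Seq as" "is_seq as \<Longrightarrow> Th a \<noteq> Seq as"
  by (auto dest!: arg_cong[of _ _ raw_of] simp: raw_of_Seq)

lemma Th_inject: "Th a = Th b \<longleftrightarrow> a = b"
  by (metis raw.inject(1) raw_of_Th raw_of_inject)

lemma Seq_inject: "is_seq as \<Longrightarrow> is_seq bs \<Longrightarrow> Seq as = Seq bs \<longleftrightarrow> as = bs"
  by (auto dest!: arg_cong[of _ _ raw_of] simp: raw_of_Seq raw_of_inject inj_map_eq_map inj_def)

lemma E_set_simps: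
  "E_set Om = {}" "E_set (Th a) = {Th a}" "is_seq as \<Longrightarrow> E_set (Seq as) = (\<Union>a\<in>set as. E_set a)"
  by (auto simp: E_set_def raw_of_Seq Th_def [symmetric])

lemma raw_E_ok: "raw_ok a \<Longrightarrow> c \<in> raw_E a \<Longrightarrow> raw_ok c"
  by (induction a rule: raw_E.induct) auto

lemma raw_of_image_E_set: "raw_of ` E_set a = raw_E (raw_of a)"
  unfolding E_set_def image_image
  using raw_E_ok[OF raw_ok_raw_of[of a]] by (force simp: to_term_inverse)

lemma oless_simps:
  "\<not> Om \<prec> Om"
  "\<not> Om \<prec> Th b"
  "is_seq bs \<Longrightarrow> Om \<prec> Seq bs \<longleftrightarrow> bs \<noteq> [] \<and> Om \<preceq> bs ! 0"
  "Th a \<prec> Om"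
  "is_seq bs \<Longrightarrow> Th a \<prec> Seq bs \<longleftrightarrow> bs \<noteq> [] \<and> Th a \<preceq> bs ! 0"
  "Th a \<prec> Th b \<longleftrightarrow> (a \<prec> b \<and> (\<forall>c\<in>E_set a. c \<prec> Th b)) \<or> (\<exists>c\<in>E_set b. Th a \<preceq> c)"
  "is_seq as \<Longrightarrow> Seq as \<prec> Om \<longleftrightarrow> as = [] \<or> as ! 0 \<prec> Om"
  "is_seq as \<Longrightarrow> Seq as \<prec> Th b \<longleftrightarrow> as = [] \<or> as ! 0 \<prec> Th b"
  "is_seq as \<Longrightarrow> is_seq bs \<Longrightarrow> Seq as \<prec> Seq bs \<longleftrightarrow>
     (length as < length bs \<and> take (length as) bs = as) \<or>
     (\<exists>j < min (length as) (length bs). take j as = take j bs \<and> as ! j \<prec> bs ! j)"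
proof goal_cases
  case 6
  have eq: "Th a = c \<longleftrightarrow> RTh (raw_of a) = raw_of c" for c
    by (metis raw_of_Th raw_of_inject)
  show ?case
    by (auto simp: oless_def oleq_def eq simp flip: raw_of_image_E_set)
next
  case 9
  have m: "map raw_of xs = map raw_of ys \<longleftrightarrow> xs = ys" for xs ys
    by (simp add: inj_map_eq_map inj_def raw_of_inject)
  show ?case using 9
    by (auto simp: oless_def raw_of_Seq take_map m)
next
  case 5
  have "Th a = c \<longleftrightarrow> RTh (raw_of a) = raw_of c" for c
    by (metis raw_of_Th raw_of_inject)
  with 5 show ?case
    by (cases bs) (auto simp: oless_def oleq_def raw_of_Seq)
next
  case 3
  then show ?case
    by (cases bs) (auto simp: oless_def oleq_def raw_of_Seq eq_commute[of ROm] eq_commute[of Om])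
next
  case 7
  then show ?case by (cases as) (auto simp: oless_def raw_of_Seq)
next
  case 8
  then show ?case by (cases as) (auto simp: oless_def raw_of_Seq)
qed (auto simp: oless_def)

definition principal :: "oterm \<Rightarrow> bool" where
  "principal a \<longleftrightarrow> a = Om \<or> (\<exists>b. a = Th b)"

text \<open>
  \<open>entries\<close> and \<open>of_entries\<close> implement the identification of \<open>\<Omega>\<close> and \<open>\<vartheta>\<alpha>\<close> with the one-element
  sequences \<open>\<langle>\<Omega>\<rangle>\<close> and \<open>\<langle>\<vartheta>\<alpha>\<rangle>\<close>, which are not terms themselves.
\<close>

definition entries :: "oterm \<Rightarrow> oterm list" where
  "entries a = (if principal a then [a] else (THE as. is_seq as \<and> a = Seq as))"

definition of_entries :: "oterm list \<Rightarrow> oterm" where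
  "of_entries as = (if length as = 1 \<and> principal (as ! 0) then as ! 0 else Seq as)"

lemma not_principal_Seq: "is_seq as \<Longrightarrow> \<not> principal (Seq as)"
  by (metis oterm_distinct(2,3) principal_def)

lemma entries_simps:
  "entries Om = [Om]" "entries (Th a) = [Th a]" "is_seq as \<Longrightarrow> entries (Seq as) = as"
  by (auto simp: entries_def not_principal_Seq Seq_inject) (auto simp: principal_def)

definition oadd :: "oterm \<Rightarrow> oterm \<Rightarrow> oterm" (infixl "\<oplus>" 65) where
  "a \<oplus> b = (let as = entries a; bs = entries b in
     if bs = [] then a
     else of_entries
       (take (Max (insert 0 {k. 0 < k \<and> k \<le> length as \<and> bs ! 0 \<preceq> as ! (k - 1)})) as @ bs))"

definition onum :: "nat \<Rightarrow> oterm" where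
  "onum n = Seq (replicate n (Seq []))"

definition omega :: oterm where
  "omega = Seq [onum 1]"

lemma is_seq_Nil: "is_seq []"
  by (simp add: is_seq_def)

lemma is_seq_onum: "is_seq (replicate n (Seq []))"
  using oterm_distinct(2,3)[OF is_seq_Nil, THEN not_sym] by (auto simp: is_seq_def oleq_def)

lemma onum_inject: "onum m = onum n \<longleftrightarrow> m = n"
  by (auto simp: onum_def Seq_inject is_seq_onum dest: arg_cong[of _ _ length])

lemma not_oless_zero: "\<not> a \<prec> Seq []"
  by (cases a rule: oterm_cases) (simp_all add: oless_simps is_seq_Nil)

lemma oless_one: "a \<prec> onum 1 \<longleftrightarrow> a = Seq []"
proof -
  have 1: "is_seq [Seq []]" using is_seq_onum[of 1] by simp
  show ?thesis
    using oterm_distinct(2,3)[OF is_seq_Nil]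
    by (cases a rule: oterm_cases)
      (auto simp: onum_def oless_simps 1 is_seq_Nil oleq_def not_oless_zero Seq_inject)
qed

lemma oless_omega_iff: "\<gamma> \<prec> omega \<longleftrightarrow> (\<exists>n. \<gamma> = onum n)"
proof -
  have np: "onum 1 \<noteq> Om" "onum 1 \<noteq> Th b" for b
    using oterm_distinct(2,3)[OF is_seq_onum[of 1], THEN not_sym] by (simp_all add: onum_def)
  then have om: "is_seq [onum 1]" by (simp add: is_seq_def)
  show ?thesis
  proof
    assume *: "\<gamma> \<prec> omega"
    show "\<exists>n. \<gamma> = onum n"
    proof (cases \<gamma> rule: oterm_cases)
      case (Seq as)
      have "as = [] \<or> as ! 0 = Seq []"
        using * Seq by (auto simp: omega_def oless_simps om oless_one simp del: One_nat_def)
      then have "as ! i = Seq []" if "i < length as" for i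
        using that
      proof (induction i)
        case (Suc i)
        then have "as ! Suc i \<preceq> Seq []" using Seq(1) by (auto simp: is_seq_def)
        then show ?case by (simp add: oleq_def not_oless_zero)
      qed auto
      then have "as = replicate (length as) (Seq [])" by (simp add: list_eq_iff_nth_eq)
      then show ?thesis using Seq(2) unfolding onum_def by metis
    qed (use * np oterm_distinct(2,3)[OF is_seq_Nil] in
      \<open>auto simp: omega_def oless_simps om oleq_def oless_one np [THEN not_sym] simp del: One_nat_def\<close>)
  next
    assume "\<exists>n. \<gamma> = onum n"
    then obtain n where n: "\<gamma> = Seq (replicate n (Seq []))" by (auto simp: onum_def)
    show "\<gamma> \<prec> omega"
      using is_seq_onum[of n] oless_one[of "Seq []"]
      unfolding n omega_def oless_simps(9)[OF is_seq_onum om] by (cases n) auto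
  qed
qed

definition omega_times :: "oterm \<Rightarrow> oterm" where
  "omega_times a = (if principal a then a else Seq (map (\<lambda>x. onum 1 \<oplus> x) (entries a)))"

definition omega_pow :: "oterm \<Rightarrow> oterm" where
  "omega_pow a = (if principal a then a else Seq [a])"

definition omax :: "oterm \<Rightarrow> oterm \<Rightarrow> oterm" where
  "omax a b = (if a \<prec> b then b else a)"


section \<open>Coefficient sets and operators\<close>

inductive_set C_set :: "oterm \<Rightarrow> oterm \<Rightarrow> oterm set" for \<alpha> \<beta> where
  Om: "Om \<in> C_set \<alpha> \<beta>"
| below: "\<gamma> \<prec> \<beta> \<Longrightarrow> \<gamma> \<in> C_set \<alpha> \<beta>"
| Th: "\<gamma> \<in> C_set \<alpha> \<beta> \<Longrightarrow> \<gamma> \<prec> \<alpha> \<Longrightarrow> Th \<gamma> \<in> C_set \<alpha> \<beta>"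
| Seq: "is_seq \<gamma>s \<Longrightarrow> \<forall>\<gamma>\<in>set \<gamma>s. \<gamma> \<in> C_set \<alpha> \<beta> \<Longrightarrow> Seq \<gamma>s \<in> C_set \<alpha> \<beta>"

type_synonym operator = "oterm set \<Rightarrow> oterm set"

definition Hull :: "oterm \<Rightarrow> operator" where
  "Hull \<alpha> Y = \<Inter>{C_set \<gamma> \<delta> |\<gamma> \<delta>. \<alpha> \<prec> \<gamma> \<and> Y \<subseteq> C_set \<gamma> \<delta>}"

definition relativize :: "operator \<Rightarrow> oterm set \<Rightarrow> operator" where
  "relativize H Z X = H (Z \<union> X)"


section \<open>The language\<close>

datatype tm = Var nat | Zero | Succ tm | Plus tm tm | Times tm tm

text \<open>
  Formulas in negation normal form over unary predicate symbols of type \<open>'p\<close> and the language of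
  arithmetic, with de Bruijn indices for variables.
\<close>

datatype 'p fm =
    Eq tm tm
  | NEq tm tm
  | Pos 'p tm
  | Neg 'p tm
  | Or "'p fm" "'p fm"
  | And "'p fm" "'p fm"
  | Exists "'p fm"
  | Forall "'p fm"

primrec lift_tm :: "tm \<Rightarrow> tm" where
  "lift_tm (Var i) = Var (Suc i)"
| "lift_tm Zero = Zero"
| "lift_tm (Succ t) = Succ (lift_tm t)"
| "lift_tm (Plus s t) = Plus (lift_tm s) (lift_tm t)"
| "lift_tm (Times s t) = Times (lift_tm s) (lift_tm t)"

primrec subst_tm :: "nat \<Rightarrow> tm \<Rightarrow> tm \<Rightarrow> tm" where
  "subst_tm k u (Var i) = (if i < k then Var i else if i = k then u else Var (i - 1))"
| "subst_tm k u Zero = Zero"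
| "subst_tm k u (Succ t) = Succ (subst_tm k u t)"
| "subst_tm k u (Plus s t) = Plus (subst_tm k u s) (subst_tm k u t)"
| "subst_tm k u (Times s t) = Times (subst_tm k u s) (subst_tm k u t)"

primrec subst :: "nat \<Rightarrow> tm \<Rightarrow> 'p fm \<Rightarrow> 'p fm" where
  "subst k u (Eq s t) = Eq (subst_tm k u s) (subst_tm k u t)"
| "subst k u (NEq s t) = NEq (subst_tm k u s) (subst_tm k u t)"
| "subst k u (Pos P t) = Pos P (subst_tm k u t)"
| "subst k u (Neg P t) = Neg P (subst_tm k u t)"
| "subst k u (Or p q) = Or (subst k u p) (subst k u q)"
| "subst k u (And p q) = And (subst k u p) (subst k u q)"
| "subst k u (Exists p) = Exists (subst (Suc k) (lift_tm u) p)"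
| "subst k u (Forall p) = Forall (subst (Suc k) (lift_tm u) p)"

primrec free_tm :: "tm \<Rightarrow> nat set" where
  "free_tm (Var i) = {i}"
| "free_tm Zero = {}"
| "free_tm (Succ t) = free_tm t"
| "free_tm (Plus s t) = free_tm s \<union> free_tm t"
| "free_tm (Times s t) = free_tm s \<union> free_tm t"

primrec free :: "'p fm \<Rightarrow> nat set" where
  "free (Eq s t) = free_tm s \<union> free_tm t"
| "free (NEq s t) = free_tm s \<union> free_tm t"
| "free (Pos P t) = free_tm t"
| "free (Neg P t) = free_tm t"
| "free (Or p q) = free p \<union> free q"
| "free (And p q) = free p \<union> free q"
| "free (Exists p) = {i. Suc i \<in> free p}"
| "free (Forall p) = {i. Suc i \<in> free p}"

primrec neg :: "'p fm \<Rightarrow> 'p fm" where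
  "neg (Eq s t) = NEq s t"
| "neg (NEq s t) = Eq s t"
| "neg (Pos P t) = Neg P t"
| "neg (Neg P t) = Pos P t"
| "neg (Or p q) = And (neg p) (neg q)"
| "neg (And p q) = Or (neg p) (neg q)"
| "neg (Exists p) = Forall (neg p)"
| "neg (Forall p) = Exists (neg p)"

text \<open>The predicate symbols \<open>P\<close> for which a literal \<open>\<not>P t\<close> occurs as a subformula.\<close>

primrec neg_preds :: "'p fm \<Rightarrow> 'p set" where
  "neg_preds (Eq s t) = {}"
| "neg_preds (NEq s t) = {}"
| "neg_preds (Pos P t) = {}"
| "neg_preds (Neg P t) = {P}"
| "neg_preds (Or p q) = neg_preds p \<union> neg_preds q"
| "neg_preds (And p q) = neg_preds p \<union> neg_preds q"
| "neg_preds (Exists p) = neg_preds p"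
| "neg_preds (Forall p) = neg_preds p"

primrec numeral_tm :: "nat \<Rightarrow> tm" where
  "numeral_tm 0 = Zero"
| "numeral_tm (Suc n) = Succ (numeral_tm n)"

text \<open>Only used for closed terms; the value of a variable is irrelevant.\<close>

primrec val :: "tm \<Rightarrow> nat" where
  "val (Var i) = 0"
| "val Zero = 0"
| "val (Succ t) = Suc (val t)"
| "val (Plus s t) = val s + val t"
| "val (Times s t) = val s * val t"

text \<open>
  The type \<open>unit\<close> provides the single predicate symbol \<open>X\<close>; the free number variable \<open>x\<close> of an
  operator form is the one with index \<open>0\<close>.
\<close>

definition operator_form :: "unit fm \<Rightarrow> bool" where
  "operator_form \<phi> \<longleftrightarrow> free \<phi> \<subseteq> {0} \<and> neg_preds \<phi> = {}"

text \<open>\<open>Ilt \<phi> \<alpha>\<close> is the predicate symbol \<open>I\<^sub>\<phi>\<close> with superscript \<open>\<prec>\<alpha>\<close>.\<close>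

datatype pred = Ilt (form: "unit fm") (stage: oterm)

definition sentence :: "pred fm \<Rightarrow> bool" where
  "sentence \<psi> \<longleftrightarrow>
     free \<psi> = {} \<and> (\<forall>P\<in>set_fm \<psi>. operator_form (form P) \<and> stage P \<preceq> Om)"

definition Sigma_sequent :: "pred fm set \<Rightarrow> bool" where
  "Sigma_sequent \<Gamma> \<longleftrightarrow>
     finite \<Gamma> \<and> (\<forall>\<psi>\<in>\<Gamma>. sentence \<psi> \<and> (\<forall>P\<in>neg_preds \<psi>. stage P \<noteq> Om))"

definition unfold_form :: "unit fm \<Rightarrow> tm \<Rightarrow> oterm \<Rightarrow> pred fm" where
  "unfold_form \<phi> t \<gamma> = subst 0 t (map_fm (\<lambda>_. Ilt \<phi> \<gamma>) \<phi>)"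

definition params :: "pred fm \<Rightarrow> oterm set" where
  "params \<psi> = stage ` set_fm \<psi>"

primrec rk :: "pred fm \<Rightarrow> oterm" where
  "rk (Eq s t) = onum 0"
| "rk (NEq s t) = onum 0"
| "rk (Pos P t) = omega_times (stage P)"
| "rk (Neg P t) = omega_times (stage P)"
| "rk (Or p q) = omax (rk p) (rk q) \<oplus> onum 1"
| "rk (And p q) = omax (rk p) (rk q) \<oplus> onum 1"
| "rk (Exists p) = rk p \<oplus> onum 1"
| "rk (Forall p) = rk p \<oplus> onum 1"

text \<open>
  \<open>disj_of \<psi> \<delta> f\<close> says that \<open>\<psi>\<close> is assigned the disjunction of all \<open>f \<gamma>\<close> with \<open>\<gamma> \<prec> \<delta>\<close>; the values
  of \<open>f\<close> at other arguments are unconstrained.  The terms below \<open>omega\<close> are precisely the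
  \<open>onum n\<close>.
\<close>

inductive disj_of :: "pred fm \<Rightarrow> oterm \<Rightarrow> (oterm \<Rightarrow> pred fm) \<Rightarrow> bool" where
  "val s \<noteq> val t \<Longrightarrow> disj_of (Eq s t) (onum 0) f"
| "val s = val t \<Longrightarrow> disj_of (NEq s t) (onum 0) f"
| "\<forall>\<gamma>. \<gamma> \<prec> \<alpha> \<longrightarrow> f \<gamma> = unfold_form \<phi> t \<gamma> \<Longrightarrow> disj_of (Pos (Ilt \<phi> \<alpha>) t) \<alpha> f"
| "f (onum 0) = p \<Longrightarrow> f (onum 1) = q \<Longrightarrow> disj_of (Or p q) (onum 2) f"
| "\<forall>n. f (onum n) = subst 0 (numeral_tm n) p \<Longrightarrow> disj_of (Exists p) omega f"

definition conj_of :: "pred fm \<Rightarrow> oterm \<Rightarrow> (oterm \<Rightarrow> pred fm) \<Rightarrow> bool" where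
  "conj_of \<psi> \<delta> f \<longleftrightarrow> (\<exists>\<chi> g. disj_of \<chi> \<delta> g \<and> \<psi> = neg \<chi> \<and> (\<forall>\<gamma>. f \<gamma> = neg (g \<gamma>)))"


section \<open>Derivations\<close>

text \<open>
  The recursion on \<open>\<alpha>\<close> is rendered as an inductive predicate: every premise has a height strictly
  below \<open>\<alpha>\<close> and occurs positively, so the least predicate closed under the rules is the one
  determined by the recursion along the well-order \<open>\<prec>\<close>.
\<close>

inductive deriv :: "oterm \<Rightarrow> operator \<Rightarrow> oterm \<Rightarrow> pred fm set \<Rightarrow> bool" for \<rho> where
  Conj: "\<lbrakk>insert \<alpha> (\<Union>(params ` \<Gamma>)) \<subseteq> H {}; \<psi> \<in> \<Gamma>; conj_of \<psi> \<delta> f;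
     \<forall>\<gamma>. \<gamma> \<prec> \<delta> \<longrightarrow> (\<exists>\<alpha>'. \<alpha>' \<prec> \<alpha> \<and> deriv \<rho> (relativize H {\<gamma>}) \<alpha>' (\<Gamma> \<union> {f \<gamma>}))\<rbrakk>
   \<Longrightarrow> deriv \<rho> H \<alpha> \<Gamma>"
| Disj: "\<lbrakk>insert \<alpha> (\<Union>(params ` \<Gamma>)) \<subseteq> H {}; \<psi> \<in> \<Gamma>; disj_of \<psi> \<delta> f;
     \<gamma> \<prec> \<delta>; \<gamma> \<prec> \<alpha>; \<gamma> \<in> H {}; \<alpha>' \<prec> \<alpha>; deriv \<rho> H \<alpha>' (\<Gamma> \<union> {f \<gamma>})\<rbrakk>
   \<Longrightarrow> deriv \<rho> H \<alpha> \<Gamma>"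
| Cut: "\<lbrakk>insert \<alpha> (\<Union>(params ` \<Gamma>)) \<subseteq> H {}; sentence \<psi>; rk \<psi> \<prec> \<rho>; \<alpha>' \<prec> \<alpha>;
     deriv \<rho> H \<alpha>' (\<Gamma> \<union> {\<psi>}); deriv \<rho> H \<alpha>' (\<Gamma> \<union> {neg \<psi>})\<rbrakk>
   \<Longrightarrow> deriv \<rho> H \<alpha> \<Gamma>"
| Fix: "\<lbrakk>insert \<alpha> (\<Union>(params ` \<Gamma>)) \<subseteq> H {}; Om \<preceq> \<alpha>; Pos (Ilt \<phi> Om) t \<in> \<Gamma>; \<alpha>' \<prec> \<alpha>;
     deriv \<rho> H \<alpha>' (\<Gamma> \<union> {unfold_form \<phi> t Om})\<rbrakk>
   \<Longrightarrow> deriv \<rho> H \<alpha> \<Gamma>"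

abbreviation derives :: "operator \<Rightarrow> oterm \<Rightarrow> oterm \<Rightarrow> pred fm set \<Rightarrow> bool"
    ("_ \<turnstile>[_, _] _" [60, 0, 0, 60] 50) where
  "H \<turnstile>[\<alpha>, \<rho>] \<Gamma> \<equiv> deriv \<rho> H \<alpha> \<Gamma>"

end

theory Submission
  imports Defs
begin

text \<open>
  Every term of the hull of \<open>X\<close> at \<open>\<alpha>\<close> lies in \<open>C_set \<eta> (Th \<eta>)\<close> when \<open>\<alpha> \<prec> \<eta>\<close>, and the terms of
  \<open>C_set \<eta> (Th \<eta>)\<close> below \<open>Om\<close> are exactly those below \<open>Th \<eta>\<close>.  Hence all heights, stages and witnesses
  controlled by the hull collapse below \<open>Th \<eta>\<close>, and \<open>\<eta> = \<alpha> \<oplus> omega_pow \<beta>\<close> is strictly increasing in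
  \<open>\<beta>\<close>, so the rules can be reapplied after collapsing their premises.  Since a collapsed derivation
  has height below \<open>Om\<close>, a formula it derives remains derivable when positive occurrences of
  \<open>Ilt \<phi> Om\<close> are replaced by \<open>Ilt \<phi> \<sigma>\<close> for \<open>\<sigma>\<close> at least the height.  This turns Fix into an ordinary
  disjunction rule, and a cut on \<open>Pos (Ilt \<phi> Om) t\<close> into a cut on \<open>Pos (Ilt \<phi> \<sigma>) t\<close>, where the second
  premise is collapsed with \<open>\<alpha> \<oplus> omega_pow \<beta>'\<close> in place of \<open>\<alpha>\<close>; this is possible because
  \<open>\<alpha> \<oplus> omega_pow \<beta>' \<oplus> omega_pow \<beta>' \<prec> \<alpha> \<oplus> omega_pow \<beta>\<close>.
\<close>

text \<open>Keeps the numeral in \<open>onum 1\<close> from being rewritten to \<open>Suc 0\<close>,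
  so that facts about \<open>onum 1\<close> still match.\<close>

declare One_nat_def [simp del]

subsection \<open>The order on terms is linear\<close>

lemma entries_cases [case_names principal Seq]:
  obtains "principal a" "entries a = [a]"
  | as where "is_seq as" "a = Seq as" "entries a = as" "\<not> principal a"
proof (cases a rule: oterm_cases)
  case (Seq as)
  then show ?thesis using that(2) not_principal_Seq entries_simps(3) by blast
qed (use that(1) in \<open>auto simp: entries_simps principal_def\<close>)

text \<open>The only possible clash is between a principal term and a sequence with it as sole
  entry; the latter is not a term.\<close>

lemma entries_inject: "entries a = entries b \<longleftrightarrow> a = b"
proof
  assume eq: "entries a = entries b"
  have np: "is_seq [x] \<Longrightarrow> \<not> principal x" for x
    by (auto simp: is_seq_def principal_def)
  show "a = b"
    by (cases a rule: entries_cases; cases b rule: entries_cases) (metis eq np list.inject)+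
qed simp

abbreviation lex_less :: "oterm list \<Rightarrow> oterm list \<Rightarrow> bool" where
  "lex_less as bs \<equiv> (as, bs) \<in> lexord {(x, y). x \<prec> y}"

text \<open>The clauses with \<open>\<preceq>\<close> allow equality with the first entry. This
  agrees with the lexicographic order because a sequence with a principal first entry has at least
  one more entry. Order properties of sequences thereby reduce to lists.\<close>

lemma oless_iff_entries: "a \<prec> b \<longleftrightarrow> lex_less (entries a) (entries b)"
proof (cases a rule: oterm_cases; cases b rule: oterm_cases)
  fix bs
  assume "a = Om" "is_seq bs" "b = Seq bs"
  then show ?thesis
    by (cases bs rule: remdups_adj.cases)
      (auto simp: entries_simps oless_simps oleq_def is_seq_def)
next
  fix x bs
  assume "a = Th x" "is_seq bs" "b = Seq bs"
  then show ?thesis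
    by (cases bs rule: remdups_adj.cases)
      (auto simp: entries_simps oless_simps(5) oleq_def is_seq_def)
next
  fix as
  assume "a = Seq as" "is_seq as" "b = Om"
  then show ?thesis
    by (cases as) (auto simp: entries_simps oless_simps)
next
  fix as y
  assume "a = Seq as" "is_seq as" "b = Th y"
  then show ?thesis
    by (cases as) (auto simp: entries_simps oless_simps(8))
qed (auto simp: entries_simps oless_simps(9) lexord_take_index_conv)

definition osize :: "oterm \<Rightarrow> nat" where
  "osize a = size (raw_of a)"

lemma osize_Th [simp]: "osize (Th a) = Suc (osize a)"
  by (simp add: osize_def)

lemma osize_E_set: "c \<in> E_set a \<Longrightarrow> osize c \<le> osize a"
  using raw_E_size raw_of_image_E_set[of a] by (auto simp: osize_def)

lemma osize_entries:
  assumes "x \<in> set (entries a)"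
  shows "osize x \<le> osize a" "\<not> principal a \<Longrightarrow> osize x < osize a"
proof -
  have "osize x < osize a" if "\<not> principal a"
  proof (cases a rule: entries_cases)
    case (Seq as)
    then have "raw_of x \<in> set (map raw_of as)" using assms by auto
    then have "size (raw_of x) \<le> size_list size (map raw_of as)"
      by (rule size_list_estimation') simp
    then show ?thesis using Seq by (simp add: osize_def raw_of_Seq)
  qed (use that in simp)
  moreover have "osize x \<le> osize a" if "principal a"
    using that assms by (cases a rule: entries_cases) auto
  ultimately show "osize x \<le> osize a" "\<not> principal a \<Longrightarrow> osize x < osize a"
    by fastforce+
qed

lemma E_set_elim:
  assumes "c \<in> E_set a" obtains d where "c = Th d"
proof -
  have "c \<in> raw_E a \<Longrightarrow> \<exists>d. c = RTh d" for c a
    by (induction a rule: raw_E.induct) auto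
  then obtain d where "raw_of c = RTh d" using assms raw_of_image_E_set[of a] by blast
  then show thesis using that by (auto simp: raw_of_eq_Th)
qed

text \<open>Transitivity is assumed only for entries of the given lists, so that an induction on
  term size can supply it.\<close>

lemma lex_less_trans:
  assumes "\<And>x y z. x \<in> set as \<Longrightarrow> y \<in> set bs \<Longrightarrow> z \<in> set cs \<Longrightarrow> x \<prec> y \<Longrightarrow> y \<prec> z \<Longrightarrow> x \<prec> z"
    and "lex_less as bs" "lex_less bs cs"
  shows "lex_less as cs"
  using assms
proof (induction as arbitrary: bs cs)
  case Nil
  then show ?case by (cases cs) auto
next
  case (Cons a as)
  obtain b bs' where bs: "bs = b # bs'" using Cons.prems(2) by (cases bs) auto
  obtain c cs' where cs: "cs = c # cs'" using Cons.prems(3) bs by (cases cs) auto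
  have "a \<prec> c" if "a \<prec> b" "b \<prec> c"
    using Cons.prems(1)[of a b c] that bs cs by simp
  moreover have "lex_less as cs'" if "lex_less as bs'" "lex_less bs' cs'"
    using Cons.IH[OF _ that] Cons.prems(1) bs cs by (meson list.set_intros(2))
  ultimately show ?case using Cons.prems(2,3) by (auto simp: bs cs)
qed

lemma lex_less_linear:
  assumes "\<And>x y. x \<in> set as \<Longrightarrow> y \<in> set bs \<Longrightarrow> x \<prec> y \<or> x = y \<or> y \<prec> x"
  shows "lex_less as bs \<or> as = bs \<or> lex_less bs as"
  using assms
proof (induction as arbitrary: bs)
  case Nil
  then show ?case by (cases bs) auto
next
  case (Cons a as)
  show ?case
  proof (cases bs)
    case bs: (Cons b bs')
    then have "a \<prec> b \<or> a = b \<or> b \<prec> a" using Cons.prems by simp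
    moreover have "lex_less as bs' \<or> as = bs' \<or> lex_less bs' as"
      using Cons.IH Cons.prems bs by (meson list.set_intros(2))
    ultimately show ?thesis by (auto simp: bs)
  qed simp
qed

text \<open>Induction on the sum of the sizes. Passing to entries lowers this sum as soon as one of
  the terms is not principal, and the lexicographic order inherits transitivity; what remains is the
  comparison of theta terms.\<close>

lemma oless_trans: "a \<prec> b \<Longrightarrow> b \<prec> c \<Longrightarrow> a \<prec> c"
proof (induction "osize a + osize b + osize c" arbitrary: a b c rule: less_induct)
  case less
  show ?case
  proof (cases "principal a \<and> principal b \<and> principal c")
    case True
    show ?thesis
    proof (cases "b = Om \<or> c = Om")
      case True
      then show ?thesis
        using \<open>principal a \<and> principal b \<and> principal c\<close> less.prems
        by (auto simp: principal_def oless_simps)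
    next
      case False
      then obtain a' b' c' where eq: "a = Th a'" "b = Th b'" "c = Th c'"
        using True less.prems by (auto simp: principal_def oless_simps)
      have ab: "(a' \<prec> b' \<and> (\<forall>d\<in>E_set a'. d \<prec> b)) \<or> (\<exists>d\<in>E_set b'. a \<preceq> d)"
        and bc: "(b' \<prec> c' \<and> (\<forall>d\<in>E_set b'. d \<prec> c)) \<or> (\<exists>d\<in>E_set c'. b \<preceq> d)"
        using less.prems by (simp_all add: eq oless_simps(6))
      \<comment> \<open>Each use of the induction hypothesis replaces one theta term by an element
        of some \<open>E_set\<close>, or all three by their arguments, which lowers the sum of the
        sizes.\<close>
      have 1: "a \<prec> d" if "d \<in> E_set c'" "b \<prec> d" for d
        using less.hyps[of a b d] osize_E_set[OF that(1)] that(2) less.prems by (simp add: eq)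
      have 2: "d \<prec> c" if "d \<in> E_set a'" "d \<prec> b" for d
        using less.hyps[of d b c] osize_E_set[OF that(1)] that(2) less.prems by (simp add: eq)
      have 3: "a \<prec> c" if "d \<in> E_set b'" "a \<prec> d" "d \<prec> c" for d
        using less.hyps[of a d c] osize_E_set[OF that(1)] that(2,3) by (simp add: eq)
      have 4: "a' \<prec> c'" if "a' \<prec> b'" "b' \<prec> c'"
        using less.hyps[of a' b' c'] that by (simp add: eq)
      have goal: "a \<prec> c \<longleftrightarrow>
          (a' \<prec> c' \<and> (\<forall>d\<in>E_set a'. d \<prec> c)) \<or> (\<exists>d\<in>E_set c'. a \<preceq> d)"
        by (simp add: eq oless_simps(6))
      show ?thesis
      proof (cases "\<exists>d\<in>E_set c'. b \<preceq> d")
        case True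
        then show ?thesis using 1 less.prems(1) unfolding goal oleq_def by blast
      next
        case False
        then have bc': "b' \<prec> c'" "\<forall>d\<in>E_set b'. d \<prec> c" using bc by auto
        then show ?thesis using ab 2 3 4 goal unfolding oleq_def by blast
      qed
    qed
  next
    case False
    have "x \<prec> z"
      if "x \<in> set (entries a)" "y \<in> set (entries b)" "z \<in> set (entries c)" "x \<prec> y" "y \<prec> z"
      for x y z
      using less.hyps[of x y z] that(4,5) False osize_entries[OF that(1)]
        osize_entries[OF that(2)] osize_entries[OF that(3)] by linarith
    then show ?thesis
      using lex_less_trans less.prems
      unfolding oless_iff_entries[of a b] oless_iff_entries[of b c] oless_iff_entries[of a c]
      by blast
  qed
qed

text \<open>For theta terms with \<open>a' \<prec> b'\<close>, either all of \<open>E_set a'\<close>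
  lies below \<open>b\<close>, and then \<open>a \<prec> b\<close>, or some element is at least
  \<open>b\<close>, and then \<open>b \<prec> a\<close>.\<close>

lemma oless_linear: "a \<prec> b \<or> a = b \<or> b \<prec> a"
proof (induction "osize a + osize b" arbitrary: a b rule: less_induct)
  case less
  show ?case
  proof (cases "principal a \<and> principal b")
    case True
    show ?thesis
    proof (cases "a = Om \<or> b = Om")
      case True
      then show ?thesis
        using \<open>principal a \<and> principal b\<close> by (auto simp: principal_def oless_simps)
    next
      case False
      then obtain a' b' where eq: "a = Th a'" "b = Th b'"
        using True by (auto simp: principal_def)
      have "a' \<prec> b' \<or> a' = b' \<or> b' \<prec> a'"
        using less.hyps by (simp add: eq)
      moreover have "d \<prec> b \<or> d = b \<or> b \<prec> d" if "d \<in> E_set a'" for d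
        using less.hyps[of d b] osize_E_set[OF that] by (simp add: eq)
      moreover have "d \<prec> a \<or> d = a \<or> a \<prec> d" if "d \<in> E_set b'" for d
        using less.hyps[of d a] osize_E_set[OF that] by (simp add: eq)
      ultimately show ?thesis by (auto simp: eq oless_simps(6) oleq_def)
    qed
  next
    case False
    have "x \<prec> y \<or> x = y \<or> y \<prec> x" if "x \<in> set (entries a)" "y \<in> set (entries b)" for x y
      using less.hyps[of x y] False osize_entries[OF that(1)] osize_entries[OF that(2)]
      by linarith
    then show ?thesis
      using lex_less_linear
      unfolding oless_iff_entries[of a b] oless_iff_entries[of b a]
        entries_inject[of a b, symmetric]
      by blast
  qed
qed

lemma oless_Th_if_E_set: "c \<in> E_set a \<Longrightarrow> c \<prec> Th a"
  using E_set_elim[of c a] oless_simps(6) oleq_def by metis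

text \<open>A theta term \<open>a\<close> at or below an element \<open>c\<close> of the
  \<open>E_set\<close> of its argument would give \<open>c \<prec> c\<close> by transitivity, and
  \<open>c\<close> is smaller in size.\<close>

lemma oless_irrefl: "\<not> a \<prec> a"
proof (induction "osize a" arbitrary: a rule: less_induct)
  case less
  show ?case
  proof (cases "principal a")
    case True
    then consider "a = Om" | b where "a = Th b" by (auto simp: principal_def)
    then show ?thesis
    proof cases
      case (2 b)
      have "\<not> a \<preceq> c" if "c \<in> E_set b" for c
        using less[of c] osize_E_set[OF that] oless_Th_if_E_set[OF that] oless_trans[of c a c]
        by (auto simp: 2 oleq_def)
      then show ?thesis using less[of b] by (auto simp: 2 oless_simps(6))
    qed (simp add: oless_simps)
  next
    case False
    then have "\<not> x \<prec> x" if "x \<in> set (entries a)" for x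
      using less osize_entries(2)[OF that] by blast
    then have "\<not> lex_less (entries a) (entries a)"
      by (induction "entries a" rule: list.induct) (auto simp: lexord_take_index_conv)
    then show ?thesis using oless_iff_entries by blast
  qed
qed

interpretation oterm: linorder "(\<preceq>)" "(\<prec>)"
proof
  show "x \<prec> y \<longleftrightarrow> x \<preceq> y \<and> \<not> y \<preceq> x" for x y
    using oless_trans oless_irrefl by (auto simp: oleq_def)
  show "x \<preceq> y \<or> y \<preceq> x" for x y
    using oless_linear[of x y] by (auto simp: oleq_def)
qed (use oless_trans oless_irrefl in \<open>auto simp: oleq_def\<close>)

subsection \<open>Addition\<close>

abbreviation decreasing :: "oterm list \<Rightarrow> bool" where
  "decreasing \<equiv> sorted_wrt (\<lambda>x y. y \<preceq> x)"

lemma is_seq_iff_decreasing: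
  "is_seq as \<longleftrightarrow> decreasing as \<and> (\<forall>a. as = [a] \<longrightarrow> \<not> principal a)"
proof -
  have "transp (\<lambda>x y. y \<preceq> x)" by (auto intro: transpI oterm.order.trans)
  then have "decreasing as \<longleftrightarrow> (\<forall>i. Suc i < length as \<longrightarrow> as ! Suc i \<preceq> as ! i)"
    by (simp add: sorted_wrt_iff_nth_Suc_transp)
  then show ?thesis
    by (cases as rule: remdups_adj.cases) (auto simp: is_seq_def principal_def)
qed

lemma decreasing_entries: "decreasing (entries a)"
  by (cases a rule: entries_cases) (auto simp: is_seq_iff_decreasing)

lemma entries_of_entries: "decreasing as \<Longrightarrow> entries (of_entries as) = as"
  by (cases as rule: remdups_adj.cases)
    (auto simp: of_entries_def entries_def is_seq_iff_decreasing not_principal_Seq Seq_inject)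

lemma entries_zero: "entries (onum 0) = []"
  by (simp add: onum_def entries_simps is_seq_Nil)

lemma entries_onum: "entries (onum n) = replicate n (onum 0)"
  unfolding onum_def by (simp add: entries_simps is_seq_onum)

lemma entries_one: "entries (onum 1) = [onum 0]"
  by (simp add: entries_onum One_nat_def)

lemma not_principal_onum: "\<not> principal (onum n)"
  by (simp add: onum_def not_principal_Seq is_seq_onum)

lemma zero_le: "onum 0 \<preceq> a"
  using not_oless_zero[of a] by (auto simp: onum_def)

lemma le_zero_iff: "a \<preceq> onum 0 \<longleftrightarrow> a = onum 0"
  using zero_le[of a] by auto

text \<open>As \<open>entries a\<close> is decreasing, the entries that are at least
  \<open>y\<close> form an initial segment; its length is the maximum in the definition of
  \<open>\<oplus>\<close>, the inserted 0 covering the empty segment.\<close>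

lemma entries_oadd:
  assumes "entries b = y # ys"
  shows "entries (a \<oplus> b) = takeWhile (\<lambda>x. y \<preceq> x) (entries a) @ entries b"
proof -
  let ?as = "entries a" and ?n = "length (takeWhile (\<lambda>x. y \<preceq> x) (entries a))"
  have "Max (insert 0 {k. 0 < k \<and> k \<le> length ?as \<and> y \<preceq> ?as ! (k - 1)}) = ?n"
  proof (rule Max_eqI)
    fix k assume "k \<in> insert 0 {k. 0 < k \<and> k \<le> length ?as \<and> y \<preceq> ?as ! (k - 1)}"
    then have k: "k = 0 \<or> (0 < k \<and> k \<le> length ?as \<and> y \<preceq> ?as ! (k - 1))" by auto
    show "k \<le> ?n"
    proof (rule ccontr)
      assume "\<not> k \<le> ?n"
      then have *: "?n \<le> k - 1" "k - 1 < length ?as" "y \<preceq> ?as ! (k - 1)" using k by auto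
      then have "?as ! (k - 1) \<preceq> ?as ! ?n"
        using decreasing_entries[of a]
        by (cases "?n = k - 1") (auto simp: sorted_wrt_iff_nth_less)
      moreover have "\<not> y \<preceq> ?as ! ?n"
        using nth_length_takeWhile[of "\<lambda>x. y \<preceq> x" ?as] *(1,2) by simp
      ultimately show False using *(3) by order
    qed
  next
    show "?n \<in> insert 0 {k. 0 < k \<and> k \<le> length ?as \<and> y \<preceq> ?as ! (k - 1)}"
    proof (cases "?n = 0")
      case False
      then have "y \<preceq> ?as ! (?n - 1)"
        using takeWhile_nth[of "?n - 1" "\<lambda>x. y \<preceq> x" ?as]
          set_takeWhileD[OF nth_mem[of "?n - 1" "takeWhile (\<lambda>x. y \<preceq> x) ?as"]]
        by simp
      then show ?thesis using False length_takeWhile_le[of _ ?as] by auto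
    qed simp
  qed simp
  then have "a \<oplus> b = of_entries (takeWhile (\<lambda>x. y \<preceq> x) ?as @ entries b)"
    by (simp add: oadd_def assms flip: takeWhile_eq_take)
  moreover have "decreasing (takeWhile (\<lambda>x. y \<preceq> x) ?as @ entries b)"
  proof -
    have "v \<preceq> y" if "v \<in> set (entries b)" for v
      using decreasing_entries[of b] that by (auto simp: assms)
    moreover have "decreasing (takeWhile (\<lambda>x. y \<preceq> x) ?as)"
      by (subst takeWhile_eq_take) (intro sorted_wrt_take decreasing_entries)
    ultimately show ?thesis
      using decreasing_entries[of b]
      by (auto simp: sorted_wrt_append dest!: set_takeWhileD intro: oterm.order.trans)
  qed
  ultimately show ?thesis by (simp add: entries_of_entries)
qed

lemma oadd_zero_right: "entries b = [] \<Longrightarrow> a \<oplus> b = a"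
  by (simp add: oadd_def)

text \<open>A principal term is its own only entry, so both cases of \<open>omega_pow\<close> give
  the same list. Adding \<open>omega_pow b\<close> thus drops the entries below \<open>b\<close> and
  appends \<open>b\<close>.\<close>

lemma entries_omega_pow: "entries (omega_pow b) = [b]"
proof (cases "principal b")
  case False
  then have "is_seq [b]" by (simp add: is_seq_iff_decreasing)
  then show ?thesis using False by (simp add: omega_pow_def entries_simps)
qed (simp add: omega_pow_def entries_def)

lemma entries_oadd_omega_pow:
  "entries (a \<oplus> omega_pow b) = takeWhile (\<lambda>x. b \<preceq> x) (entries a) @ [b]"
  using entries_oadd[of "omega_pow b" b "[]"] by (simp add: entries_omega_pow)

lemma entries_oadd_one: "entries (a \<oplus> onum 1) = entries a @ [onum 0]"
proof -
  have "takeWhile (\<lambda>x. onum 0 \<preceq> x) (entries a) = entries a"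
    by (simp add: zero_le)
  then show ?thesis using entries_oadd[OF entries_one] by (simp add: entries_one)
qed

text \<open>Either all entries are kept and the list grows, or the first dropped entry is replaced
  by the larger \<open>b\<close>.\<close>

lemma oless_oadd_omega_pow: "a \<prec> a \<oplus> omega_pow b"
proof -
  have "lex_less as (takeWhile (\<lambda>x. b \<preceq> x) as @ [b])" for as
    by (induction as) auto
  then show ?thesis
    by (simp add: oless_iff_entries[of a "a \<oplus> omega_pow b"] entries_oadd_omega_pow)
qed

text \<open>The lists agree on the entries that are at least \<open>c\<close>. Then the right one
  has \<open>c\<close>, while the left one has \<open>b\<close> or an entry of \<open>a\<close>
  below \<open>c\<close>.\<close>

lemma oadd_omega_pow_strict_mono:
  assumes "b \<prec> c"
  shows "a \<oplus> omega_pow b \<prec> a \<oplus> omega_pow c"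
proof -
  have "lex_less (takeWhile (\<lambda>x. b \<preceq> x) as @ [b]) (takeWhile (\<lambda>x. c \<preceq> x) as @ [c])" for as
    using assms by (induction as) auto
  then show ?thesis
    by (simp add: oless_iff_entries[of "a \<oplus> omega_pow b" "a \<oplus> omega_pow c"]
        entries_oadd_omega_pow)
qed

text \<open>The second copy of \<open>b\<close> comes after the first difference and cannot affect
  the comparison.\<close>

lemma oadd_omega_pow_twice_less:
  assumes "b \<prec> c"
  shows "a \<oplus> omega_pow b \<oplus> omega_pow b \<prec> a \<oplus> omega_pow c"
proof -
  have *: "lex_less (takeWhile (\<lambda>x. b \<preceq> x) as @ [b, b]) (takeWhile (\<lambda>x. c \<preceq> x) as @ [c])" for as
    using assms by (induction as) auto
  \<comment> \<open>The first copy of \<open>b\<close> survives the second addition, since all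
    entries present are at least \<open>b\<close>.\<close>
  have "takeWhile (\<lambda>x. b \<preceq> x) (takeWhile (\<lambda>x. b \<preceq> x) as @ [b]) =
      takeWhile (\<lambda>x. b \<preceq> x) as @ [b]" for as
    by (induction as) auto
  then show ?thesis
    using *[of "entries a"]
    by (simp add: oless_iff_entries[of "a \<oplus> omega_pow b \<oplus> omega_pow b" "a \<oplus> omega_pow c"]
        entries_oadd_omega_pow)
qed

section \<open>Theta subterms of sums, and numerals below theta terms\<close>

lemma E_set_entries: "E_set a = (\<Union>x\<in>set (entries a). E_set x)"
  by (cases a rule: oterm_cases) (simp_all add: entries_simps E_set_simps)

lemma E_set_oadd_omega_pow: "E_set (a \<oplus> omega_pow b) \<subseteq> E_set a \<union> E_set b"
  using E_set_entries[of "a \<oplus> omega_pow b"] E_set_entries[of a]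
  by (auto simp: entries_oadd_omega_pow dest: set_takeWhileD)

lemma less_Th_iff_hd_entries: "\<not> principal a \<Longrightarrow> a \<prec> Th b \<longleftrightarrow> entries a = [] \<or> hd (entries a) \<prec> Th b"
proof (cases a rule: entries_cases)
  case (Seq as)
  then show ?thesis by (cases as) (auto simp: oless_simps(8))
qed simp

lemma zero_less_Th: "onum 0 \<prec> Th b"
  by (simp add: less_Th_iff_hd_entries not_principal_onum entries_zero)

lemma onum_less_Th: "onum n \<prec> Th b"
  by (cases n) (simp_all add: less_Th_iff_hd_entries not_principal_onum entries_onum[of "Suc _"] zero_less_Th)

lemma entries_omega: "entries omega = [onum 1]" "\<not> principal omega"
proof -
  have "is_seq [onum 1]" by (simp add: is_seq_iff_decreasing not_principal_onum)
  then show "entries omega = [onum 1]" "\<not> principal omega"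
    by (simp_all add: omega_def entries_simps not_principal_Seq)
qed

lemma omega_less_Th: "omega \<prec> Th b"
  using onum_less_Th[of 1 b] by (simp add: less_Th_iff_hd_entries entries_omega)

lemma onum_less_iff: "onum m \<prec> onum n \<longleftrightarrow> m < n"
proof -
  have less: "onum m \<prec> onum n" if "m < n" for m n
  proof -
    have "replicate n (onum 0) = replicate m (onum 0) @ replicate (n - m) (onum 0)"
      using that by (simp flip: replicate_add)
    moreover have "replicate (n - m) (onum 0) \<noteq> []" using that by simp
    ultimately show ?thesis
      unfolding oless_iff_entries[of "onum m" "onum n"] entries_onum
      by (metis append_Nil2 lexord_append_rightI neq_Nil_conv)
  qed
  then show ?thesis by (metis linorder_neqE_nat oterm.order.asym oterm.order.irrefl)
qed

lemma less_onum_2: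
  assumes "\<gamma> \<prec> onum 2" shows "\<gamma> = onum 0 \<or> \<gamma> = onum 1"
proof -
  have "\<gamma> \<prec> omega" using assms oless_omega_iff by (metis oterm.order.strict_trans)
  then obtain n where n: "\<gamma> = onum n" by (auto simp: oless_omega_iff)
  then have "n = 0 \<or> n = 1" using assms by (auto simp: onum_less_iff)
  then show ?thesis using n by blast
qed

subsection \<open>Coefficient sets\<close>

lemma oterm_induct [case_names Om Th Seq]:
  assumes "P Om" "\<And>a. P a \<Longrightarrow> P (Th a)"
    "\<And>as. is_seq as \<Longrightarrow> (\<And>a. a \<in> set as \<Longrightarrow> P a) \<Longrightarrow> P (Seq as)"
  shows "P a"
proof (induction "osize a" arbitrary: a rule: less_induct)
  case less
  show ?case
  proof (cases a rule: oterm_cases)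
    case (Seq as)
    then show ?thesis
      using assms(3) less osize_entries(2)[of _ a] by (simp add: entries_simps not_principal_Seq)
  qed (use assms less in auto)
qed

text \<open>Entries are decreasing, so \<open>c\<close> is at most the first one, and a theta term
  at most the first entry of a sequence is below the sequence.\<close>

lemma E_set_le: "c \<in> E_set a \<Longrightarrow> c \<preceq> a"
proof (induction a rule: oterm_induct)
  case (Seq as)
  then obtain x where x: "x \<in> set as" "c \<in> E_set x" "c \<preceq> x" by (auto simp: E_set_simps)
  obtain d where d: "c = Th d" using Seq.prems by (rule E_set_elim)
  have "x \<preceq> as ! 0"
    using Seq(1) x(1) by (cases as) (auto simp: is_seq_iff_decreasing)
  then have "c \<preceq> as ! 0" using x(3) by order
  then have "c \<prec> Seq as" using Seq(1) x(1) d by (auto simp: oless_simps(5))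
  then show ?case by simp
qed (auto simp: E_set_simps)

text \<open>Forwards, the clause \<open>below\<close> is harmless by \<open>E_set_le\<close>.
  Backwards, every term is built from \<open>Om\<close> and its \<open>E_set\<close> by forming
  sequences, under which \<open>C_set\<close> is closed.\<close>

lemma C_set_iff_E_set: "\<gamma> \<in> C_set \<alpha> \<beta> \<longleftrightarrow> E_set \<gamma> \<subseteq> C_set \<alpha> \<beta>"
proof
  show "\<gamma> \<in> C_set \<alpha> \<beta> \<Longrightarrow> E_set \<gamma> \<subseteq> C_set \<alpha> \<beta>"
  proof (induction rule: C_set.induct)
    case (below \<gamma>)
    then show ?case
      using E_set_le by (meson C_set.below oterm.order.strict_trans1 subsetI)
  qed (auto simp: E_set_simps intro: C_set.intros)
  show "E_set \<gamma> \<subseteq> C_set \<alpha> \<beta> \<Longrightarrow> \<gamma> \<in> C_set \<alpha> \<beta>"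
    by (induction \<gamma> rule: oterm_induct) (auto simp: E_set_simps UN_subset_iff intro: C_set.intros)
qed

text \<open>Closing under the clause \<open>Th\<close> creates no theta term beyond those below
  \<open>Th \<xi>\<close>: if \<open>\<gamma> \<prec> \<xi>\<close> and
  \<open>E_set \<gamma>\<close> lies below \<open>Th \<xi>\<close>, the first clause of the order
  gives \<open>Th \<gamma> \<prec> Th \<xi>\<close>.\<close>

lemma C_set_Th_iff: "\<gamma> \<in> C_set \<xi> (Th \<xi>) \<longleftrightarrow> (\<forall>c\<in>E_set \<gamma>. c \<prec> Th \<xi>)"
proof
  show "\<gamma> \<in> C_set \<xi> (Th \<xi>) \<Longrightarrow> \<forall>c\<in>E_set \<gamma>. c \<prec> Th \<xi>"
  proof (induction rule: C_set.induct)
    case (below \<gamma>)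
    then show ?case using E_set_le by (meson oterm.order.strict_trans1)
  qed (auto simp: E_set_simps oless_simps(6))
  show "\<forall>c\<in>E_set \<gamma>. c \<prec> Th \<xi> \<Longrightarrow> \<gamma> \<in> C_set \<xi> (Th \<xi>)"
    using C_set_iff_E_set[of \<gamma>] C_set.below by blast
qed

text \<open>A sequence below \<open>Om\<close> is empty or has its first entry below
  \<open>Om\<close>; by induction that entry is below \<open>Th \<xi>\<close>, and it alone decides
  the comparison.\<close>

lemma C_set_Th_below_Om:
  assumes "\<gamma> \<in> C_set \<xi> (Th \<xi>)" "\<gamma> \<prec> Om"
  shows "\<gamma> \<prec> Th \<xi>"
  using assms unfolding C_set_Th_iff
proof (induction \<gamma> rule: oterm_induct)
  case (Seq as)
  then show ?case by (cases as) (auto simp: oless_simps E_set_simps)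
qed (auto simp: oless_simps E_set_simps)

lemma Th_less_Th_if_C_set: "\<gamma> \<prec> \<xi> \<Longrightarrow> \<gamma> \<in> C_set \<xi> (Th \<xi>) \<Longrightarrow> Th \<gamma> \<prec> Th \<xi>"
  by (simp add: C_set_Th_iff oless_simps(6))

section \<open>Monotonicity and closure of hulls\<close>

lemma Hull_mono: "\<alpha> \<preceq> \<alpha>' \<Longrightarrow> Y \<subseteq> Y' \<Longrightarrow> Hull \<alpha> Y \<subseteq> Hull \<alpha>' Y'"
  unfolding Hull_def by (rule Inter_anti_mono) (use oterm.order.strict_trans1 in blast)

lemma Hull_subset_C_set: "\<alpha> \<prec> \<gamma> \<Longrightarrow> Y \<subseteq> C_set \<gamma> \<delta> \<Longrightarrow> Hull \<alpha> Y \<subseteq> C_set \<gamma> \<delta>"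
  unfolding Hull_def by blast

lemma Hull_iff_E_set: "\<gamma> \<in> Hull \<alpha> Y \<longleftrightarrow> E_set \<gamma> \<subseteq> Hull \<alpha> Y"
  unfolding Hull_def using C_set_iff_E_set[of \<gamma>] by blast

text \<open>The sum has no theta subterms in its \<open>E_set\<close> other than those of
  \<open>\<gamma>\<close> and \<open>\<beta>\<close>, and these decide membership in the
  hull.\<close>

lemma oadd_omega_pow_in_Hull:
  "\<gamma> \<in> Hull \<alpha> Y \<Longrightarrow> \<beta> \<in> Hull \<alpha> Y \<Longrightarrow> \<gamma> \<oplus> omega_pow \<beta> \<in> Hull \<alpha> Y"
  using E_set_oadd_omega_pow[of \<gamma> \<beta>] Hull_iff_E_set[of _ \<alpha> Y] by blast

text \<open>The hull at \<open>\<gamma>\<close> intersects only sets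
  \<open>C_set \<xi> \<delta>\<close> with \<open>\<gamma> \<prec> \<xi>\<close>, which is the side
  condition of the clause \<open>Th\<close>.\<close>

lemma Th_in_Hull: "\<gamma> \<in> Hull \<gamma> Y \<Longrightarrow> Th \<gamma> \<in> Hull \<gamma> Y"
  unfolding Hull_def by (auto intro: C_set.Th)

subsection \<open>Ranks\<close>

text \<open>The entry 0 of \<open>onum 1\<close> is absorbed by any first entry other than
  0.\<close>

lemma entries_one_oadd:
  "entries (onum 1 \<oplus> a) =
    (if entries a = [] \<or> hd (entries a) = onum 0 then onum 0 # entries a else entries a)"
proof (cases "entries a")
  case Nil
  then show ?thesis by (simp add: oadd_zero_right entries_one)
next
  case (Cons x xs)
  then show ?thesis using entries_oadd[OF Cons, of "onum 1"]
    by (auto simp: entries_one le_zero_iff)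
qed

text \<open>Ensures that \<open>omega_times\<close> does not turn the entry of a one-entry sequence
  into a principal term, which would not give a genuine sequence.\<close>

lemma principal_one_oadd:
  assumes "principal (onum 1 \<oplus> a)" shows "principal a"
proof -
  have "entries (onum 1 \<oplus> a) = [onum 1 \<oplus> a]" using assms by (simp add: entries_def)
  then have "entries a = entries (onum 1 \<oplus> a) \<or> principal (onum 0)"
    using assms entries_one_oadd[of a] by (metis list.inject)
  then show ?thesis using assms by (auto simp: entries_inject not_principal_onum)
qed

lemma one_oadd_mono:
  assumes "a \<preceq> b" shows "onum 1 \<oplus> a \<preceq> onum 1 \<oplus> b"
proof (cases "a = b")
  case False
  then have ab: "lex_less (entries a) (entries b)"
    using assms oless_iff_entries[of a b] by (simp add: oleq_def)
  have pos: "onum 0 \<prec> x \<longleftrightarrow> x \<noteq> onum 0" for x using zero_le[of x] by (auto simp: oleq_def)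
  have "lex_less (entries (onum 1 \<oplus> a)) (entries (onum 1 \<oplus> b))"
    unfolding entries_one_oadd using ab
    by (cases "entries a"; cases "entries b") (auto simp: pos entries_zero)
  then show ?thesis using oless_iff_entries[of "onum 1 \<oplus> a" "onum 1 \<oplus> b"] by simp
qed simp

lemma is_seq_omega_times:
  assumes "\<not> principal a"
  shows "is_seq (map (\<lambda>x. onum 1 \<oplus> x) (entries a))"
proof -
  have "is_seq (entries a)" using assms by (cases a rule: entries_cases) auto
  then show ?thesis
    using principal_one_oadd one_oadd_mono
    by (auto simp: is_seq_iff_decreasing sorted_wrt_map elim!: sorted_wrt_mono_rel[rotated])
qed

lemma omega_times_eq_Om: "omega_times a = Om \<longleftrightarrow> a = Om"
  using oterm_distinct(2)[OF is_seq_omega_times[of a]]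
  by (auto simp: omega_times_def principal_def)

lemma one_oadd_less_Th:
  assumes "a \<prec> Th \<xi>" shows "onum 1 \<oplus> a \<prec> Th \<xi>"
proof (cases "principal (onum 1 \<oplus> a)")
  case True
  then have "entries (onum 1 \<oplus> a) = [onum 1 \<oplus> a]" "onum 1 \<oplus> a \<noteq> onum 0"
    using not_principal_onum by (auto simp: entries_def)
  then have "onum 1 \<oplus> a = a" using entries_one_oadd[of a]
    by (metis entries_inject list.inject)
  then show ?thesis using assms by simp
next
  case False
  have "hd (entries a) \<prec> Th \<xi>" if "entries a \<noteq> []"
    using assms that oless_iff_entries[of a "Th \<xi>"]
    by (cases "entries a") (auto simp: entries_simps)
  then show ?thesis using zero_less_Th
    by (simp add: less_Th_iff_hd_entries[OF False] entries_one_oadd)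
qed

lemma omega_times_less_Th:
  assumes "a \<prec> Th \<xi>" shows "omega_times a \<prec> Th \<xi>"
proof (cases "principal a")
  case False
  have "is_seq (map (\<lambda>x. onum 1 \<oplus> x) (entries a))" by (rule is_seq_omega_times[OF False])
  then show ?thesis
    using assms False one_oadd_less_Th
    by (cases "entries a") (auto simp: omega_times_def oless_simps(8) less_Th_iff_hd_entries)
qed (use assms in \<open>simp add: omega_times_def\<close>)

text \<open>Appending the least entry 0 yields the immediate lexicographic successor.\<close>

lemma oless_oadd_one_iff: "a \<prec> b \<oplus> onum 1 \<longleftrightarrow> a \<preceq> b"
proof -
  have "lex_less as (bs @ [onum 0]) \<longleftrightarrow> lex_less as bs \<or> as = bs" for as bs
  proof (induction as arbitrary: bs)
    case Nil
    then show ?case by (cases bs) auto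
  next
    case (Cons x as)
    then show ?case by (cases bs) (auto simp: onum_def not_oless_zero)
  qed
  then show ?thesis
    using oless_iff_entries[of a b] oless_iff_entries[of a "b \<oplus> onum 1"] entries_inject[of a b]
    by (simp add: entries_oadd_one oleq_def)
qed

lemma oadd_one_less_Th:
  assumes "a \<prec> Th \<xi>" shows "a \<oplus> onum 1 \<prec> Th \<xi>"
  using assms oless_iff_entries[of a "Th \<xi>"] oless_iff_entries[of "a \<oplus> onum 1" "Th \<xi>"] zero_less_Th
  by (cases "entries a") (auto simp: entries_oadd_one entries_simps)

lemma oadd_one_neq_Om: "a \<oplus> onum 1 \<noteq> Om"
proof
  assume "a \<oplus> onum 1 = Om"
  then have "entries a @ [onum 0] = [Om]" using entries_oadd_one[of a] by (simp add: entries_simps)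
  then show False using not_principal_onum[of 0] by (auto simp: principal_def)
qed

lemma omax_cases: "omax a b = a \<or> omax a b = b" "a \<preceq> omax a b" "b \<preceq> omax a b"
  by (auto simp: omax_def)

text \<open>The terms below \<open>Th \<xi>\<close> contain 0 and are closed under
  \<open>omega_times\<close>, \<open>omax\<close> and successor.\<close>

lemma rk_less_Th: "\<forall>s\<in>params \<psi>. s \<prec> Th \<xi> \<Longrightarrow> rk \<psi> \<prec> Th \<xi>"
proof (induction \<psi>)
  case (Or p q)
  then show ?case using omax_cases(1)[of "rk p" "rk q"] oadd_one_less_Th by (auto simp: params_def)
next
  case (And p q)
  then show ?case using omax_cases(1)[of "rk p" "rk q"] oadd_one_less_Th by (auto simp: params_def)
qed (auto simp: params_def zero_less_Th omega_times_less_Th intro: oadd_one_less_Th)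

lemma Om_le_rk: "Om \<in> params \<psi> \<Longrightarrow> Om \<preceq> rk \<psi>"
proof (induction \<psi>)
  case (Or p q)
  then have "Om \<preceq> omax (rk p) (rk q)"
    using omax_cases(2,3)[where a = "rk p" and b = "rk q"]
    by (auto simp: params_def image_Un intro: oterm.order.trans)
  then show ?case by (simp add: oless_oadd_one_iff oterm.order.strict_implies_order)
next
  case (And p q)
  then have "Om \<preceq> omax (rk p) (rk q)"
    using omax_cases(2,3)[where a = "rk p" and b = "rk q"]
    by (auto simp: params_def image_Un intro: oterm.order.trans)
  then show ?case by (simp add: oless_oadd_one_iff oterm.order.strict_implies_order)
qed (auto simp: params_def oless_oadd_one_iff oterm.order.strict_implies_order omega_times_def principal_def)

text \<open>Compound formulas have successor ranks and \<open>Om\<close> is no successor; among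
  literals, \<open>omega_times\<close> takes the value \<open>Om\<close> only at \<open>Om\<close>.
  Together with \<open>Om_le_rk\<close>, a cut formula of rank at most \<open>Om\<close> in which
  stage \<open>Om\<close> occurs is a literal.\<close>

lemma rk_eq_Om:
  assumes "rk \<psi> = Om"
  obtains \<phi> t where "\<psi> = Pos (Ilt \<phi> Om) t \<or> \<psi> = Neg (Ilt \<phi> Om) t"
proof -
  have "\<exists>\<phi> t. \<psi> = Pos (Ilt \<phi> Om) t \<or> \<psi> = Neg (Ilt \<phi> Om) t"
    using assms oadd_one_neq_Om not_principal_onum[of 0]
    by (cases \<psi>) (auto simp: omega_times_eq_Om principal_def, (metis pred.collapse)+)
  then show thesis using that by blast
qed

subsection \<open>Formulas\<close>

lemma neg_neg [simp]: "neg (neg p) = p"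
  by (induction p) auto

lemma set_fm_neg [simp]: "set_fm (neg p) = set_fm p"
  by (induction p) auto

lemma free_neg [simp]: "free (neg p) = free p"
  by (induction p) auto

lemma neg_preds_subset: "neg_preds p \<subseteq> set_fm p"
  by (induction p) auto

lemma neg_preds_neg_subset: "neg_preds (neg p) \<subseteq> set_fm p"
  using neg_preds_subset[of "neg p"] by simp

lemma sentence_neg [simp]: "sentence (neg p) \<longleftrightarrow> sentence p"
  by (simp add: sentence_def)

lemma set_fm_subst [simp]: "set_fm (subst k u p) = set_fm p"
  by (induction p arbitrary: k u) auto

lemma neg_preds_subst [simp]: "neg_preds (subst k u p) = neg_preds p"
  by (induction p arbitrary: k u) auto

lemma neg_preds_map_fm: "neg_preds (map_fm g p) = g ` neg_preds p"
  by (induction p) auto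

lemma free_map_fm [simp]: "free (map_fm g p) = free p"
  by (induction p) auto

lemma subst_neg: "subst k u (neg p) = neg (subst k u p)"
  by (induction p arbitrary: k u) auto

lemma free_tm_lift_tm: "free_tm (lift_tm t) = Suc ` free_tm t"
  by (induction t) auto

lemma free_subst_tm: "free_tm u = {} \<Longrightarrow> free_tm t \<subseteq> {..k} \<Longrightarrow> free_tm (subst_tm k u t) \<subseteq> {..<k}"
  by (induction t) auto

lemma free_subst: "free_tm u = {} \<Longrightarrow> free p \<subseteq> {..k} \<Longrightarrow> free (subst k u p) \<subseteq> {..<k}"
proof (induction p arbitrary: k u)
  case (Exists p)
  have "free p \<subseteq> {..Suc k}"
  proof
    fix i assume "i \<in> free p"
    then show "i \<in> {..Suc k}" using Exists.prems(2) by (cases i) auto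
  qed
  then have "free (subst (Suc k) (lift_tm u) p) \<subseteq> {..<Suc k}"
    using Exists by (simp add: free_tm_lift_tm)
  then show ?case by auto
next
  case (Forall p)
  have "free p \<subseteq> {..Suc k}"
  proof
    fix i assume "i \<in> free p"
    then show "i \<in> {..Suc k}" using Forall.prems(2) by (cases i) auto
  qed
  then have "free (subst (Suc k) (lift_tm u) p) \<subseteq> {..<Suc k}"
    using Forall by (simp add: free_tm_lift_tm)
  then show ?case by auto
qed (simp_all add: free_subst_tm)

lemma free_numeral_tm [simp]: "free_tm (numeral_tm n) = {}"
  by (induction n) auto

lemma set_fm_unfold_form: "set_fm (unfold_form \<phi> t \<gamma>) \<subseteq> {Ilt \<phi> \<gamma>}"
  by (auto simp: unfold_form_def fm.set_map)

lemma neg_preds_unfold_form: "operator_form \<phi> \<Longrightarrow> neg_preds (unfold_form \<phi> t \<gamma>) = {}"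
  by (simp add: unfold_form_def neg_preds_map_fm operator_form_def)

lemma sentence_unfold_form:
  assumes "operator_form \<phi>" "free_tm t = {}" "\<gamma> \<preceq> Om"
  shows "sentence (unfold_form \<phi> t \<gamma>)"
proof -
  have "free (unfold_form \<phi> t \<gamma>) \<subseteq> {..<0}"
    unfolding unfold_form_def using assms by (intro free_subst) (auto simp: operator_form_def)
  then show ?thesis
    using assms set_fm_unfold_form[of \<phi> t \<gamma>] by (auto simp: sentence_def)
qed

section \<open>Sigma sentences and their immediate subformulas\<close>

abbreviation Sigma_sentence :: "pred fm \<Rightarrow> bool" where
  "Sigma_sentence \<psi> \<equiv> sentence \<psi> \<and> (\<forall>P\<in>neg_preds \<psi>. stage P \<noteq> Om)"

lemma onum_less_Om: "onum n \<prec> Om"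
  using onum_less_Th[of n] oless_simps(4) by (rule oterm.order.strict_trans)

lemma omega_less_Om: "omega \<prec> Om"
  using omega_less_Th oless_simps(4) by (rule oterm.order.strict_trans)

lemma disj_of_index_le_Om: "disj_of \<psi> \<delta> f \<Longrightarrow> sentence \<psi> \<Longrightarrow> \<delta> \<preceq> Om"
  by (erule disj_of.cases)
    (auto simp: sentence_def oterm.order.strict_implies_order onum_less_Om omega_less_Om)

lemma sentence_disj_of:
  assumes "disj_of \<psi> \<delta> f" "sentence \<psi>" "\<gamma> \<prec> \<delta>"
  shows "sentence (f \<gamma>)"
  using assms(1)
proof cases
  case (3 \<phi> t)
  then have "operator_form \<phi>" "free_tm t = {}" "\<delta> \<preceq> Om" using assms(2) by (auto simp: sentence_def)
  moreover have "\<gamma> \<preceq> Om" using \<open>\<delta> \<preceq> Om\<close> assms(3) by order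
  ultimately show ?thesis using 3 assms(3) sentence_unfold_form by auto
next
  case (4 p q)
  then show ?thesis using less_onum_2 assms(2,3) by (auto simp: sentence_def)
next
  case (5 p)
  then obtain n where \<gamma>: "\<gamma> = onum n" using assms(3) by (auto simp: oless_omega_iff)
  have "i = 0" if "i \<in> free p" for i
    using assms(2) that 5(1) by (cases i) (auto simp: sentence_def)
  then have "free (subst 0 (numeral_tm n) p) \<subseteq> {..<0}" by (intro free_subst) auto
  then show ?thesis using assms(2) 5 \<gamma> by (auto simp: sentence_def)
\<comment> \<open>False arithmetic literals have an empty index set, so no \<open>\<gamma>\<close>
  exists.\<close>
qed (use assms(3) not_oless_zero in \<open>auto simp: onum_def\<close>)

lemma Sigma_disj_of:
  assumes "disj_of \<psi> \<delta> f" "Sigma_sentence \<psi>" "\<gamma> \<prec> \<delta>"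
  shows "Sigma_sentence (f \<gamma>)"
proof -
  have "\<forall>P\<in>neg_preds (f \<gamma>). stage P \<noteq> Om"
    using assms(1)
  proof cases
    case (3 \<phi> t)
    then show ?thesis
      using assms(2,3) neg_preds_unfold_form by (auto simp: sentence_def)
  next
    case (4 p q)
    then show ?thesis using less_onum_2 assms(2,3) by auto
  next
    case (5 p)
    then show ?thesis using assms(2,3) by (auto simp: oless_omega_iff)
  qed (use assms(3) not_oless_zero in \<open>auto simp: onum_def\<close>)
  then show ?thesis using sentence_disj_of assms by blast
qed

text \<open>The critical case is a negative literal: its conjuncts negate predicates of stage
  \<open>\<gamma>\<close> only, and \<open>\<gamma> \<prec> \<delta> \<preceq> Om\<close> excludes
  stage \<open>Om\<close>.\<close>

lemma Sigma_conj_of: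
  assumes "conj_of \<psi> \<delta> f" "Sigma_sentence \<psi>" "\<gamma> \<prec> \<delta>"
  shows "Sigma_sentence (f \<gamma>)"
proof -
  obtain \<chi> g where \<chi>: "disj_of \<chi> \<delta> g" "\<psi> = neg \<chi>" "\<And>\<gamma>. f \<gamma> = neg (g \<gamma>)"
    using assms(1) by (auto simp: conj_of_def)
  have "\<forall>P\<in>neg_preds (neg (g \<gamma>)). stage P \<noteq> Om"
    using \<chi>(1)
  proof cases
    case (3 \<phi> t)
    then have "\<delta> \<preceq> Om" using assms(2) \<chi>(2) by (auto simp: sentence_def)
    then have "\<gamma> \<noteq> Om" using assms(3) by order
    then show ?thesis
      using 3 assms(3) neg_preds_neg_subset[of "g \<gamma>"] set_fm_unfold_form[of \<phi> t \<gamma>] by auto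
  next
    case (4 p q)
    then show ?thesis using less_onum_2 assms(2,3) \<chi>(2) by auto
  next
    case (5 p)
    then show ?thesis
      using assms(2,3) \<chi>(2) by (auto simp: oless_omega_iff simp flip: subst_neg)
  qed (use assms(3) not_oless_zero in \<open>auto simp: onum_def\<close>)
  moreover have "sentence (g \<gamma>)" using sentence_disj_of \<chi> assms by auto
  ultimately show ?thesis by (simp add: \<chi>(3))
qed

text \<open>No conjunction over all terms below \<open>Om\<close> arises, as that needs a negative
  literal of stage \<open>Om\<close>. Hence the indices are controlled by the parameters and can be
  added to \<open>X\<close> when premises are collapsed.\<close>

lemma Sigma_conj_of_index:
  assumes "conj_of \<psi> \<delta> f" "Sigma_sentence \<psi>"
  obtains "\<delta> \<in> params \<psi>" "\<delta> \<prec> Om" | "\<And>\<xi>. \<delta> \<prec> Th \<xi>"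
proof -
  obtain \<chi> g where \<chi>: "disj_of \<chi> \<delta> g" "\<psi> = neg \<chi>"
    using assms(1) by (auto simp: conj_of_def)
  show thesis
    using \<chi>(1)
  proof cases
    case (3 \<phi> t)
    then show thesis
      using that(1) \<chi>(2) assms(2) by (auto simp: params_def sentence_def oleq_def)
  qed (use that(2) in \<open>auto simp: onum_less_Th omega_less_Th\<close>)
qed

text \<open>
  Negative literals keep the stage \<open>Om\<close>, so that a conjunction rule for them stays applicable
  without change.
\<close>

primrec bound :: "oterm \<Rightarrow> pred fm \<Rightarrow> pred fm" where
  "bound \<beta> (Eq s t) = Eq s t"
| "bound \<beta> (NEq s t) = NEq s t"
| "bound \<beta> (Pos P t) = Pos (if stage P = Om then Ilt (form P) \<beta> else P) t"
| "bound \<beta> (Neg P t) = Neg P t"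
| "bound \<beta> (Or p q) = Or (bound \<beta> p) (bound \<beta> q)"
| "bound \<beta> (And p q) = And (bound \<beta> p) (bound \<beta> q)"
| "bound \<beta> (Exists p) = Exists (bound \<beta> p)"
| "bound \<beta> (Forall p) = Forall (bound \<beta> p)"

lemma bound_subst: "bound \<beta> (subst k u p) = subst k u (bound \<beta> p)"
  by (induction p arbitrary: k u) auto

text \<open>Operator forms contain no negated predicate, so \<open>bound\<close> reaches every
  occurrence.\<close>

lemma bound_unfold_form:
  assumes "operator_form \<phi>"
  shows "bound \<beta> (unfold_form \<phi> t Om) = unfold_form \<phi> t \<beta>"
proof -
  have "neg_preds \<chi> = {} \<Longrightarrow> bound \<beta> (map_fm (\<lambda>_. Ilt \<phi> Om) \<chi>) = map_fm (\<lambda>_. Ilt \<phi> \<beta>) \<chi>"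
    for \<chi> :: "unit fm"
    by (induction \<chi>) auto
  then show ?thesis using assms by (simp add: unfold_form_def bound_subst operator_form_def)
qed

lemma params_bound: "params (bound \<beta> p) \<subseteq> insert \<beta> (params p)"
  by (induction p) (auto simp: params_def)

text \<open>Literals that are assigned a conjunction are arithmetic or negative, hence unchanged;
  compound formulas commute with \<open>bound\<close>.\<close>

lemma conj_of_bound:
  assumes "conj_of \<psi> \<delta> f"
  obtains "bound \<beta> \<psi> = \<psi>" | "conj_of (bound \<beta> \<psi>) \<delta> (\<lambda>\<gamma>. bound \<beta> (f \<gamma>))"
proof -
  obtain \<chi> g where \<chi>: "disj_of \<chi> \<delta> g" "\<psi> = neg \<chi>" and f: "f = (\<lambda>\<gamma>. neg (g \<gamma>))"
    using assms by (auto simp: conj_of_def)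
  have conj_ofI: "conj_of (bound \<beta> \<psi>) \<delta> (\<lambda>\<gamma>. bound \<beta> (f \<gamma>))"
    if "disj_of (neg (bound \<beta> \<psi>)) \<delta> (\<lambda>\<gamma>. neg (bound \<beta> (f \<gamma>)))"
    using that unfolding conj_of_def by (metis neg_neg)
  show thesis
    using \<chi>(1)
  proof cases
    case (4 p q)
    then have "disj_of (neg (bound \<beta> \<psi>)) \<delta> (\<lambda>\<gamma>. neg (bound \<beta> (f \<gamma>)))"
      by (auto simp: \<chi>(2) f intro: disj_of.intros)
    then show thesis using conj_ofI that(2) by blast
  next
    case (5 p)
    then have "disj_of (neg (bound \<beta> \<psi>)) \<delta> (\<lambda>\<gamma>. neg (bound \<beta> (f \<gamma>)))"
      by (auto simp: \<chi>(2) f bound_subst subst_neg intro!: disj_of.intros simp flip: subst_neg)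
    then show thesis using conj_ofI that(2) by blast
  qed (use that(1) in \<open>auto simp: \<chi>(2)\<close>)
qed

text \<open>The third alternative is the only one where bounding shrinks the index set, from
  \<open>Om\<close> to \<open>\<beta>\<close>.\<close>

lemma disj_of_bound:
  assumes "disj_of \<psi> \<delta> f"
  obtains "bound \<beta> \<psi> = \<psi>"
  | "disj_of (bound \<beta> \<psi>) \<delta> (\<lambda>\<gamma>. bound \<beta> (f \<gamma>))"
  | \<phi> t where "\<psi> = Pos (Ilt \<phi> Om) t" "\<delta> = Om"
  using assms
proof cases
  case (3 \<phi> t)
  then show thesis using that(1,3) by (cases "\<delta> = Om") auto
next
  case (4 p q)
  then have "disj_of (bound \<beta> \<psi>) \<delta> (\<lambda>\<gamma>. bound \<beta> (f \<gamma>))" by (auto intro: disj_of.intros)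
  then show thesis by (rule that(2))
next
  case (5 p)
  then have "disj_of (bound \<beta> \<psi>) \<delta> (\<lambda>\<gamma>. bound \<beta> (f \<gamma>))"
    by (auto simp: bound_subst intro!: disj_of.intros)
  then show thesis by (rule that(2))
qed (use that(1) in auto)

subsection \<open>Derivations\<close>

lemma relativize_mono: "mono H \<Longrightarrow> mono (relativize H Z)"
  by (rule monoI, unfold relativize_def, erule monoD) blast

lemma relativize_Hull: "relativize (relativize (Hull \<alpha>) X) Z = relativize (Hull \<alpha>) (X \<union> Z)"
  by (simp add: fun_eq_iff relativize_def Un_assoc)

lemma mono_relativize_Hull: "mono (relativize (Hull \<alpha>) X)"
  by (rule monoI, unfold relativize_def, rule Hull_mono) auto

lemma deriv_controlled: "deriv \<rho> H \<alpha> \<Gamma> \<Longrightarrow> insert \<alpha> (\<Union>(params ` \<Gamma>)) \<subseteq> H {}"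
  by (erule deriv.cases) auto

lemma deriv_mono:
  assumes "deriv \<rho> H \<alpha> \<Gamma>" "H \<le> H'" "\<rho> \<preceq> \<rho>'"
  shows "deriv \<rho>' H' \<alpha> \<Gamma>"
  using assms
proof (induction arbitrary: H')
  case (Conj \<alpha> \<Gamma> H \<psi> \<delta> f)
  show ?case
  proof (rule deriv.Conj[OF _ Conj.hyps(2,3)])
    show "insert \<alpha> (\<Union>(params ` \<Gamma>)) \<subseteq> H' {}"
      using Conj.hyps(1) le_funD[OF Conj.prems(1), of "{}"] by blast
    have "relativize H {\<gamma>} \<le> relativize H' {\<gamma>}" for \<gamma>
      using Conj.prems(1) by (auto simp: le_fun_def relativize_def)
    then show "\<forall>\<gamma>. \<gamma> \<prec> \<delta> \<longrightarrow>
        (\<exists>\<alpha>'. \<alpha>' \<prec> \<alpha> \<and> deriv \<rho>' (relativize H' {\<gamma>}) \<alpha>' (\<Gamma> \<union> {f \<gamma>}))"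
      using Conj.IH Conj.prems(2) by meson
  qed
next
  case (Disj \<alpha> \<Gamma> H \<psi> \<delta> f \<gamma> \<alpha>')
  then show ?case
    using le_funD[OF Disj.prems(1), of "{}"]
    by - (rule deriv.Disj[of _ _ _ \<psi> \<delta> f \<gamma> \<alpha>']; blast)
next
  case (Cut \<alpha> \<Gamma> H \<psi> \<alpha>')
  moreover have "rk \<psi> \<prec> \<rho>'" using Cut by order
  ultimately show ?case
    using le_funD[OF Cut.prems(1), of "{}"]
    by - (rule deriv.Cut[of _ _ _ \<psi> _ \<alpha>']; blast)
next
  case (Fix \<alpha> \<Gamma> H \<phi> t \<alpha>')
  then show ?case
    using le_funD[OF Fix.prems(1), of "{}"]
    by - (rule deriv.Fix[of _ _ _ \<phi> t \<alpha>']; blast)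
qed

lemma deriv_height_mono:
  assumes "deriv \<rho> H \<alpha> \<Gamma>" "\<alpha> \<preceq> \<beta>" "\<beta> \<in> H {}"
  shows "deriv \<rho> H \<beta> \<Gamma>"
  using assms(1)
proof cases
  case (Conj \<psi> \<delta> f)
  have "\<alpha>' \<prec> \<beta>" if "\<alpha>' \<prec> \<alpha>" for \<alpha>' using that assms(2) by order
  then have "\<forall>\<gamma>. \<gamma> \<prec> \<delta> \<longrightarrow> (\<exists>\<alpha>'. \<alpha>' \<prec> \<beta> \<and> deriv \<rho> (relativize H {\<gamma>}) \<alpha>' (\<Gamma> \<union> {f \<gamma>}))"
    using Conj(4) by blast
  then show ?thesis
    using Conj(1-3) assms(3) by - (rule deriv.Conj[of _ _ _ \<psi> \<delta> f], auto)
next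
  case (Disj \<psi> \<delta> f \<gamma> \<alpha>')
  then have "\<alpha>' \<prec> \<beta>" "\<gamma> \<prec> \<beta>" using assms(2) by order+
  with Disj show ?thesis
    using assms(3)
    by - (rule deriv.Disj[of _ _ _ \<psi> \<delta> f \<gamma> \<alpha>']; (blast | simp))
next
  case (Cut \<psi> \<alpha>')
  then have "\<alpha>' \<prec> \<beta>" using assms(2) by order
  with Cut show ?thesis
    using assms(3)
    by - (rule deriv.Cut[of _ _ _ \<psi> _ \<alpha>']; (blast | simp))
next
  case (Fix \<phi> t \<alpha>')
  then have "\<alpha>' \<prec> \<beta>" "Om \<preceq> \<beta>" using assms(2) by order+
  with Fix show ?thesis
    using assms(3)
    by - (rule deriv.Fix[of _ _ _ \<phi> t \<alpha>']; (blast | simp))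
qed

text \<open>Each formula of \<open>\<Delta>\<close> may be kept or bounded separately. This lets cut
  formulas pass unchanged, and also gives weakening for heights below \<open>Om\<close>.\<close>

lemma deriv_bound:
  assumes "deriv \<rho> H \<alpha> \<Delta>" "mono H" "\<alpha> \<preceq> \<beta>" "\<beta> \<prec> Om" "\<beta> \<in> H {}"
    and "\<forall>\<psi>\<in>\<Delta>. \<psi> \<in> \<Gamma> \<or> bound \<beta> \<psi> \<in> \<Gamma>" "\<Union>(params ` \<Gamma>) \<subseteq> H {}"
  shows "deriv \<rho> H \<alpha> \<Gamma>"
  using assms
proof (induction arbitrary: \<Gamma>)
  case (Conj \<alpha> \<Delta> H \<psi> \<delta> f)
  have ctrl: "insert \<alpha> (\<Union>(params ` \<Gamma>)) \<subseteq> H {}" using Conj by auto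
  have step: "\<exists>\<alpha>'. \<alpha>' \<prec> \<alpha> \<and> deriv \<rho> (relativize H {\<gamma>}) \<alpha>' (\<Gamma> \<union> {\<chi>})"
    if \<gamma>: "\<gamma> \<prec> \<delta>" and \<chi>: "\<chi> = f \<gamma> \<or> \<chi> = bound \<beta> (f \<gamma>)" for \<gamma> \<chi>
  proof -
    obtain \<alpha>' where \<alpha>': "\<alpha>' \<prec> \<alpha>" "deriv \<rho> (relativize H {\<gamma>}) \<alpha>' (\<Delta> \<union> {f \<gamma>})"
      and IH: "\<And>\<Gamma>. mono (relativize H {\<gamma>}) \<Longrightarrow> \<alpha>' \<preceq> \<beta> \<Longrightarrow> \<beta> \<prec> Om \<Longrightarrow>
        \<beta> \<in> relativize H {\<gamma>} {} \<Longrightarrow> \<forall>\<psi>\<in>\<Delta> \<union> {f \<gamma>}. \<psi> \<in> \<Gamma> \<or> bound \<beta> \<psi> \<in> \<Gamma> \<Longrightarrow>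
        \<Union>(params ` \<Gamma>) \<subseteq> relativize H {\<gamma>} {} \<Longrightarrow> deriv \<rho> (relativize H {\<gamma>}) \<alpha>' \<Gamma>"
      using Conj.IH \<gamma> by meson
    have sub: "H {} \<subseteq> relativize H {\<gamma>} {}"
      using Conj.prems(1) by (auto simp: relativize_def mono_def)
    then have \<beta>: "\<beta> \<in> relativize H {\<gamma>} {}" using Conj.prems(4) by blast
    have "params (f \<gamma>) \<subseteq> relativize H {\<gamma>} {}"
      using deriv_controlled[OF \<alpha>'(2)] by auto
    then have "\<Union>(params ` (\<Gamma> \<union> {\<chi>})) \<subseteq> relativize H {\<gamma>} {}"
      using sub \<beta> \<chi> Conj.prems(6) params_bound[of \<beta> "f \<gamma>"] by auto
    moreover have "\<alpha>' \<preceq> \<beta>" using \<alpha>'(1) Conj.prems(2) by order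
    ultimately have "deriv \<rho> (relativize H {\<gamma>}) \<alpha>' (\<Gamma> \<union> {\<chi>})"
      using Conj.prems \<beta> \<chi> by (intro IH relativize_mono) auto
    then show ?thesis using \<alpha>'(1) by blast
  qed
  have "\<psi> \<in> \<Gamma> \<or> bound \<beta> \<psi> \<in> \<Gamma>" using Conj.hyps(2) Conj.prems(5) by blast
  moreover have ?case if "\<psi> \<in> \<Gamma>"
    using ctrl that Conj.hyps(3) step by - (rule deriv.Conj[of _ _ _ \<psi> \<delta> f], auto)
  moreover have ?case if "bound \<beta> \<psi> \<in> \<Gamma>" "conj_of (bound \<beta> \<psi>) \<delta> (\<lambda>\<gamma>. bound \<beta> (f \<gamma>))"
    using ctrl that step by - (rule deriv.Conj[of _ _ _ "bound \<beta> \<psi>" \<delta> "\<lambda>\<gamma>. bound \<beta> (f \<gamma>)"], auto)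
  ultimately show ?case
    by (cases rule: conj_of_bound[OF Conj.hyps(3), of \<beta>]) auto
next
  case (Disj \<alpha> \<Delta> H \<psi> \<delta> f \<gamma> \<alpha>')
  have ctrl: "insert \<alpha> (\<Union>(params ` \<Gamma>)) \<subseteq> H {}" using Disj by auto
  have "params (f \<gamma>) \<subseteq> H {}" using deriv_controlled[OF Disj.hyps(8)] by auto
  then have step: "deriv \<rho> H \<alpha>' (\<Gamma> \<union> {\<chi>})" if "\<chi> = f \<gamma> \<or> \<chi> = bound \<beta> (f \<gamma>)" for \<chi>
    using that Disj.prems params_bound[of \<beta> "f \<gamma>"] Disj.hyps(7)
    by (intro Disj.IH) (auto intro: oterm.order.trans)
  have same: ?case if "\<psi> \<in> \<Gamma>"
    using that ctrl Disj.hyps step by - (rule deriv.Disj[of _ _ _ \<psi> \<delta> f \<gamma> \<alpha>'], auto)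
  show ?case
  proof (cases "\<psi> \<in> \<Gamma>")
    case False
    then have b: "bound \<beta> \<psi> \<in> \<Gamma>" using Disj.hyps(2) Disj.prems(5) by blast
    from Disj.hyps(3) show ?thesis
    proof (cases rule: disj_of_bound[where \<beta> = \<beta>])
      case 1
      then show ?thesis using b False by simp
    next
      case 2
      then show ?thesis
        using ctrl b Disj.hyps step
        by - (rule deriv.Disj[of _ _ _ "bound \<beta> \<psi>" \<delta> "\<lambda>\<gamma>. bound \<beta> (f \<gamma>)" \<gamma> \<alpha>'], auto)
    next
      case (3 \<phi> t)
      \<comment> \<open>The rule keeps its witness below the height, so it remains an admissible
        index. The premise retains \<open>f \<gamma>\<close> unbounded, since both literals have the
        same disjunct at \<open>\<gamma>\<close>.\<close>
      have "\<gamma> \<prec> \<beta>" using Disj.hyps(5) Disj.prems(2) by order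
      have "f \<gamma> = unfold_form \<phi> t \<gamma>"
        using Disj.hyps(3,4) by (cases rule: disj_of.cases) (auto simp: 3)
      moreover have "disj_of (Pos (Ilt \<phi> \<beta>) t) \<beta> (\<lambda>\<gamma>. unfold_form \<phi> t \<gamma>)"
        by (auto intro: disj_of.intros)
      ultimately show ?thesis
        using ctrl b Disj.hyps step[of "f \<gamma>"] 3 \<open>\<gamma> \<prec> \<beta>\<close>
        by - (rule deriv.Disj[of _ _ _ "bound \<beta> \<psi>" \<beta> "\<lambda>\<gamma>. unfold_form \<phi> t \<gamma>" \<gamma> \<alpha>'], auto)
    qed
  qed (rule same)
next
  case (Cut \<alpha> \<Delta> H \<psi> \<alpha>')
  have "params \<psi> \<subseteq> H {}" "params (neg \<psi>) \<subseteq> H {}"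
    using deriv_controlled[OF Cut.hyps(5)] deriv_controlled[OF Cut.hyps(6)] by auto
  moreover have "\<alpha>' \<preceq> \<beta>" using Cut.hyps(4) Cut.prems(2) by order
  ultimately have "deriv \<rho> H \<alpha>' (\<Gamma> \<union> {\<psi>})" "deriv \<rho> H \<alpha>' (\<Gamma> \<union> {neg \<psi>})"
    using Cut.prems by (blast intro!: Cut.IH(1), blast intro!: Cut.IH(2))
  then show ?case using Cut by - (rule deriv.Cut[of _ _ _ \<psi> _ \<alpha>'], auto)
next
  case (Fix \<alpha> \<Delta> H \<phi> t \<alpha>')
  \<comment> \<open>The rule requires \<open>Om \<preceq> \<alpha>\<close>, contradicting
    \<open>\<alpha> \<preceq> \<beta> \<prec> Om\<close>.\<close>
  then have "Om \<prec> Om" by order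
  then show ?case by simp
qed

subsection \<open>Collapsing\<close>

lemma Th_collapse_in_Hull:
  assumes "\<alpha> \<in> Hull \<alpha> X" "\<beta> \<in> Hull \<alpha> X"
  shows "Th (\<alpha> \<oplus> omega_pow \<beta>) \<in> Hull (\<alpha> \<oplus> omega_pow \<beta>) X"
proof -
  have "\<alpha> \<preceq> \<alpha> \<oplus> omega_pow \<beta>" using oless_oadd_omega_pow by (rule oterm.order.strict_implies_order)
  then show ?thesis
    using Th_in_Hull Hull_mono[of \<alpha> "\<alpha> \<oplus> omega_pow \<beta>" X X] oadd_omega_pow_in_Hull[OF assms] by blast
qed

text \<open>The hypothesis on \<open>X\<close> puts the hull inside
  \<open>C_set \<eta> (Th \<eta>)\<close> for
  \<open>\<eta> = \<alpha> \<oplus> omega_pow \<beta>\<close>, where theta terms compare like their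
  arguments when these are below \<open>\<eta>\<close>.\<close>

lemma Th_collapse_less:
  assumes "\<alpha> \<in> Hull \<alpha> X" "\<beta>' \<in> Hull \<alpha> X" "\<beta>' \<prec> \<beta>" "\<forall>\<xi>. \<alpha> \<prec> \<xi> \<longrightarrow> X \<subseteq> C_set \<xi> (Th \<xi>)"
  shows "Th (\<alpha> \<oplus> omega_pow \<beta>') \<prec> Th (\<alpha> \<oplus> omega_pow \<beta>)"
    "Th (\<alpha> \<oplus> omega_pow \<beta>' \<oplus> omega_pow \<beta>') \<prec> Th (\<alpha> \<oplus> omega_pow \<beta>)"
proof -
  let ?\<eta> = "\<alpha> \<oplus> omega_pow \<beta>"
  have "Hull \<alpha> X \<subseteq> C_set ?\<eta> (Th ?\<eta>)"
    using assms(4) oless_oadd_omega_pow by (intro Hull_subset_C_set) auto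
  then show "Th (\<alpha> \<oplus> omega_pow \<beta>') \<prec> Th ?\<eta>" "Th (\<alpha> \<oplus> omega_pow \<beta>' \<oplus> omega_pow \<beta>') \<prec> Th ?\<eta>"
    using oadd_omega_pow_strict_mono[OF assms(3)] oadd_omega_pow_twice_less[OF assms(3)]
      oadd_omega_pow_in_Hull[OF _ assms(2)] assms(1)
    by (blast intro: Th_less_Th_if_C_set)+
qed

lemma deriv_relativize_Hull_mono:
  assumes "deriv \<rho> (relativize (Hull \<alpha>) X) \<beta> \<Gamma>" "\<alpha> \<preceq> \<alpha>'" "\<rho> \<preceq> \<rho>'"
  shows "deriv \<rho>' (relativize (Hull \<alpha>') X) \<beta> \<Gamma>"
  using assms(1) _ assms(3)
proof (rule deriv_mono)
  show "relativize (Hull \<alpha>) X \<le> relativize (Hull \<alpha>') X"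
    unfolding le_fun_def relativize_def using Hull_mono[OF assms(2)] by blast
qed

text \<open>
  The Cut on \<open>Pos (Ilt \<phi> Om) t\<close> needs the induction hypothesis for a sequent in which
  \<open>Neg (Ilt \<phi> Om) t\<close> has been replaced by an instance with a smaller stage, and for a larger
  operator.  Building both into the statement allows an induction over the derivation itself
  instead of one over its height.
\<close>

lemma collapsing:
  assumes "deriv (Om \<oplus> onum 1) H \<beta> \<Delta>" "H \<le> relativize (Hull \<alpha>) X" "\<alpha> \<in> Hull \<alpha> X"
    and "\<forall>\<xi>. \<alpha> \<prec> \<xi> \<longrightarrow> X \<subseteq> C_set \<xi> (Th \<xi>)"
    and "Sigma_sequent \<Gamma>" "\<Union>(params ` \<Gamma>) \<subseteq> Hull \<alpha> X"
    and "\<forall>\<psi>\<in>\<Delta>. \<psi> \<in> \<Gamma> \<or> (\<exists>\<phi> t \<delta>. \<psi> = Neg (Ilt \<phi> Om) t \<and> Neg (Ilt \<phi> \<delta>) t \<in> \<Gamma>)"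
  shows "deriv (Th (\<alpha> \<oplus> omega_pow \<beta>)) (relativize (Hull (\<alpha> \<oplus> omega_pow \<beta>)) X)
    (Th (\<alpha> \<oplus> omega_pow \<beta>)) \<Gamma>"
  using assms
proof (induction arbitrary: \<alpha> X \<Gamma>)
  case (Conj \<beta> \<Delta> H \<psi> \<delta> f)
  define \<eta> where "\<eta> = \<alpha> \<oplus> omega_pow \<beta>"
  have \<beta>: "\<beta> \<in> Hull \<alpha> X"
    using Conj.hyps(1) le_funD[OF Conj.prems(1), of "{}"] by (auto simp: relativize_def)
  have ctrl: "insert (Th \<eta>) (\<Union>(params ` \<Gamma>)) \<subseteq> relativize (Hull \<eta>) X {}"
    using Th_collapse_in_Hull[OF Conj.prems(2) \<beta>] Conj.prems(5) oless_oadd_omega_pow[of \<alpha> \<beta>]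
      Hull_mono[of \<alpha> \<eta> X X] by (auto simp: relativize_def \<eta>_def oleq_def)
  \<comment> \<open>A replaced negative literal has the same conjuncts over a possibly smaller index
    set, so a subset of the given premises suffices.\<close>
  obtain \<psi>' \<delta>' where \<psi>': "\<psi>' \<in> \<Gamma>" "conj_of \<psi>' \<delta>' f" "\<delta>' \<preceq> \<delta>"
  proof (cases "\<psi> \<in> \<Gamma>")
    case False
    then obtain \<phi> t \<sigma> where *: "\<psi> = Neg (Ilt \<phi> Om) t" "Neg (Ilt \<phi> \<sigma>) t \<in> \<Gamma>"
      using Conj.hyps(2) Conj.prems(6) by blast
    obtain g where g: "disj_of (Pos (Ilt \<phi> Om) t) \<delta> g" "\<And>\<gamma>. f \<gamma> = neg (g \<gamma>)"
      using Conj.hyps(3) unfolding conj_of_def *(1) by (metis neg.simps(4) neg_neg)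
    have \<sigma>: "\<sigma> \<preceq> Om" using *(2) Conj.prems(4) by (auto simp: Sigma_sequent_def sentence_def)
    have "\<delta> = Om" "\<forall>\<gamma>. \<gamma> \<prec> Om \<longrightarrow> g \<gamma> = unfold_form \<phi> t \<gamma>"
      using g(1) by (auto elim: disj_of.cases)
    then have "disj_of (Pos (Ilt \<phi> \<sigma>) t) \<sigma> g"
      using \<sigma> by (intro disj_of.intros) (meson oterm.order.strict_trans2)
    then have "conj_of (Neg (Ilt \<phi> \<sigma>) t) \<sigma> f"
      unfolding conj_of_def using g(2) by (metis neg.simps(3))
    then show thesis using that *(2) \<sigma> \<open>\<delta> = Om\<close> by blast
  qed (use that Conj.hyps(3) in auto)
  have Sigma: "Sigma_sentence \<psi>'" using Conj.prems(4) \<psi>'(1) by (auto simp: Sigma_sequent_def)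
  have step: "\<exists>\<beta>'. \<beta>' \<prec> Th \<eta> \<and>
      deriv (Th \<eta>) (relativize (relativize (Hull \<eta>) X) {\<gamma>}) \<beta>' (\<Gamma> \<union> {f \<gamma>})"
    if \<gamma>: "\<gamma> \<prec> \<delta>'" for \<gamma>
  proof -
    let ?X = "X \<union> {\<gamma>}"
    have "\<gamma> \<prec> \<delta>" using \<gamma> \<psi>'(3) by order
    then obtain \<beta>' where \<beta>': "\<beta>' \<prec> \<beta>"
        "deriv (Om \<oplus> onum 1) (relativize H {\<gamma>}) \<beta>' (\<Delta> \<union> {f \<gamma>})"
      and IH: "\<forall>\<alpha> X. relativize H {\<gamma>} \<le> relativize (Hull \<alpha>) X \<longrightarrow> \<alpha> \<in> Hull \<alpha> X \<longrightarrow>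
        (\<forall>\<xi>. \<alpha> \<prec> \<xi> \<longrightarrow> X \<subseteq> C_set \<xi> (Th \<xi>)) \<longrightarrow> (\<forall>\<Gamma>. Sigma_sequent \<Gamma> \<longrightarrow>
        \<Union>(params ` \<Gamma>) \<subseteq> Hull \<alpha> X \<longrightarrow>
        (\<forall>\<psi>\<in>\<Delta> \<union> {f \<gamma>}. \<psi> \<in> \<Gamma> \<or>
          (\<exists>\<phi> t \<delta>. \<psi> = Neg (Ilt \<phi> Om) t \<and> Neg (Ilt \<phi> \<delta>) t \<in> \<Gamma>)) \<longrightarrow>
        deriv (Th (\<alpha> \<oplus> omega_pow \<beta>')) (relativize (Hull (\<alpha> \<oplus> omega_pow \<beta>')) X)
          (Th (\<alpha> \<oplus> omega_pow \<beta>')) \<Gamma>)"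
      using Conj.IH[THEN spec, THEN mp, OF \<open>\<gamma> \<prec> \<delta>\<close>] by (elim exE conjE) (rule that)
    have le: "relativize H {\<gamma>} \<le> relativize (Hull \<alpha>) ?X"
      using le_funD[OF Conj.prems(1)] unfolding le_fun_def relativize_def
      by (metis Un_assoc)
    have sub: "Hull \<alpha> X \<subseteq> Hull \<alpha> ?X" by (rule Hull_mono) auto
    \<comment> \<open>The premise is collapsed with \<open>\<gamma>\<close> added to
      \<open>X\<close>. The condition on \<open>X\<close> persists because \<open>\<delta>'\<close>,
      and with it \<open>\<gamma>\<close>, is below \<open>Th \<xi>\<close>.\<close>
    have C: "?X \<subseteq> C_set \<xi> (Th \<xi>)" if "\<alpha> \<prec> \<xi>" for \<xi>
    proof -
      have "\<delta>' \<prec> Th \<xi>"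
        using \<psi>'(2) Sigma
      proof (cases rule: Sigma_conj_of_index)
        case 1
        then have "\<delta>' \<in> C_set \<xi> (Th \<xi>)"
          using Conj.prems(3,5) \<psi>'(1) that Hull_subset_C_set[OF that] by blast
        then show ?thesis using 1(2) by (rule C_set_Th_below_Om)
      qed
      then have "\<gamma> \<prec> Th \<xi>" using \<gamma> by order
      then show ?thesis using Conj.prems(3) that by (auto intro: C_set.below)
    qed
    have ctrl': "insert \<beta>' (params (f \<gamma>)) \<subseteq> Hull \<alpha> ?X"
      using deriv_controlled[OF \<beta>'(2)] le_funD[OF le, of "{}"] by (auto simp: relativize_def)
    have "deriv (Th (\<alpha> \<oplus> omega_pow \<beta>')) (relativize (Hull (\<alpha> \<oplus> omega_pow \<beta>')) ?X)
        (Th (\<alpha> \<oplus> omega_pow \<beta>')) (\<Gamma> \<union> {f \<gamma>})"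
    proof (rule IH[rule_format, OF le])
      show "Sigma_sequent (\<Gamma> \<union> {f \<gamma>})"
        using Conj.prems(4) Sigma_conj_of[OF \<psi>'(2) Sigma \<gamma>] by (auto simp: Sigma_sequent_def)
    qed (use Conj.prems sub C ctrl' in auto)
    moreover have "Th (\<alpha> \<oplus> omega_pow \<beta>') \<prec> Th \<eta>"
      unfolding \<eta>_def using Conj.prems(2) sub ctrl' \<beta>'(1) C by (intro Th_collapse_less[of _ ?X]) auto
    moreover have "\<alpha> \<oplus> omega_pow \<beta>' \<preceq> \<eta>"
      using oadd_omega_pow_strict_mono[OF \<beta>'(1)] by (simp add: \<eta>_def oleq_def)
    ultimately show ?thesis
      unfolding relativize_Hull
      by (meson deriv_relativize_Hull_mono oterm.order.strict_implies_order)
  qed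
  show ?case
    unfolding \<eta>_def[symmetric]
    using deriv.Conj[where H = "relativize (Hull \<eta>) X", OF ctrl \<psi>'(1,2)] step by blast
next
  case (Disj \<beta> \<Delta> H \<psi> \<delta> f \<gamma> \<beta>')
  define \<eta> where "\<eta> = \<alpha> \<oplus> omega_pow \<beta>"
  have sub: "H {} \<subseteq> Hull \<alpha> X"
    using le_funD[OF Disj.prems(1), of "{}"] by (auto simp: relativize_def)
  have \<beta>: "\<beta> \<in> Hull \<alpha> X" "\<gamma> \<in> Hull \<alpha> X" using sub Disj.hyps(1,6) by auto
  have "\<alpha> \<prec> \<eta>" using oless_oadd_omega_pow[of \<alpha> \<beta>] by (simp add: \<eta>_def)
  then have sub': "Hull \<alpha> X \<subseteq> Hull \<eta> X" by (intro Hull_mono) (auto simp: oleq_def)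
  have ctrl: "insert (Th \<eta>) (\<Union>(params ` \<Gamma>)) \<subseteq> relativize (Hull \<eta>) X {}"
    using Th_collapse_in_Hull[OF Disj.prems(2) \<beta>(1)] Disj.prems(5) sub'
    by (auto simp: relativize_def \<eta>_def)
  \<comment> \<open>Negative predicate literals are assigned no disjunction, so the main formula has
    not been replaced.\<close>
  have \<psi>: "\<psi> \<in> \<Gamma>" using Disj.hyps(2,3) Disj.prems(6) by (auto elim: disj_of.cases)
  then have Sigma: "Sigma_sentence \<psi>" using Disj.prems(4) by (auto simp: Sigma_sequent_def)
  have ctrl': "insert \<beta>' (params (f \<gamma>)) \<subseteq> Hull \<alpha> X"
    using deriv_controlled[OF Disj.hyps(8)] sub by auto
  have "deriv (Th (\<alpha> \<oplus> omega_pow \<beta>')) (relativize (Hull (\<alpha> \<oplus> omega_pow \<beta>')) X)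
      (Th (\<alpha> \<oplus> omega_pow \<beta>')) (\<Gamma> \<union> {f \<gamma>})"
  proof (rule Disj.IH[OF Disj.prems(1-3)])
    show "Sigma_sequent (\<Gamma> \<union> {f \<gamma>})"
      using Disj.prems(4) Sigma_disj_of[OF Disj.hyps(3) Sigma Disj.hyps(4)]
      by (auto simp: Sigma_sequent_def)
  qed (use Disj.prems ctrl' in auto)
  moreover have less: "Th (\<alpha> \<oplus> omega_pow \<beta>') \<prec> Th \<eta>"
    unfolding \<eta>_def using Disj.prems Disj.hyps(7) ctrl' by (intro Th_collapse_less[of _ X]) auto
  moreover have "\<alpha> \<oplus> omega_pow \<beta>' \<preceq> \<eta>"
    using oadd_omega_pow_strict_mono[OF Disj.hyps(7)] by (simp add: \<eta>_def oleq_def)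
  ultimately have "deriv (Th \<eta>) (relativize (Hull \<eta>) X) (Th (\<alpha> \<oplus> omega_pow \<beta>')) (\<Gamma> \<union> {f \<gamma>})"
    by (meson deriv_relativize_Hull_mono oterm.order.strict_implies_order)
  \<comment> \<open>The rule at height \<open>Th \<eta>\<close> requires its witness to lie below
    that height.\<close>
  moreover have "\<gamma> \<prec> Th \<eta>"
  proof (rule C_set_Th_below_Om)
    show "\<gamma> \<in> C_set \<eta> (Th \<eta>)"
      using Hull_subset_C_set \<open>\<alpha> \<prec> \<eta>\<close> Disj.prems(3) \<beta>(2) by blast
    show "\<gamma> \<prec> Om" using disj_of_index_le_Om[OF Disj.hyps(3) conjunct1[OF Sigma]] Disj.hyps(4) by order
  qed
  moreover have "\<gamma> \<in> relativize (Hull \<eta>) X {}" using \<beta>(2) sub' by (auto simp: relativize_def)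
  ultimately show ?case
    unfolding \<eta>_def[symmetric]
    using deriv.Disj[where H = "relativize (Hull \<eta>) X", OF ctrl \<psi> Disj.hyps(3,4)] less by blast
next
  case (Cut \<beta> \<Delta> H \<psi> \<beta>')
  define \<eta> where "\<eta> = \<alpha> \<oplus> omega_pow \<beta>"
  define \<eta>' where "\<eta>' = \<alpha> \<oplus> omega_pow \<beta>'"
  have sub: "H {} \<subseteq> Hull \<alpha> X"
    using le_funD[OF Cut.prems(1), of "{}"] by (auto simp: relativize_def)
  have \<beta>: "\<beta> \<in> Hull \<alpha> X" using sub Cut.hyps(1) by auto
  have "\<alpha> \<prec> \<eta>" using oless_oadd_omega_pow[of \<alpha> \<beta>] by (simp add: \<eta>_def)
  then have sub': "Hull \<alpha> X \<subseteq> Hull \<eta> X" by (intro Hull_mono) (auto simp: oleq_def)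
  have ctrl: "insert (Th \<eta>) (\<Union>(params ` \<Gamma>)) \<subseteq> relativize (Hull \<eta>) X {}"
    using Th_collapse_in_Hull[OF Cut.prems(2) \<beta>(1)] Cut.prems(5) sub'
    by (auto simp: relativize_def \<eta>_def)
  have \<beta>': "\<beta>' \<in> Hull \<alpha> X" and par: "params \<psi> \<subseteq> Hull \<alpha> X" "params (neg \<psi>) \<subseteq> Hull \<alpha> X"
    using deriv_controlled[OF Cut.hyps(5)] deriv_controlled[OF Cut.hyps(6)] sub by auto
  have less: "Th \<eta>' \<prec> Th \<eta>" "Th (\<eta>' \<oplus> omega_pow \<beta>') \<prec> Th \<eta>"
    unfolding \<eta>_def \<eta>'_def
    by (rule Th_collapse_less[OF Cut.prems(2) \<beta>' Cut.hyps(4) Cut.prems(3)])+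
  have \<eta>': "\<eta>' \<prec> \<eta>" "\<eta>' \<oplus> omega_pow \<beta>' \<prec> \<eta>"
    unfolding \<eta>_def \<eta>'_def
    by (rule oadd_omega_pow_strict_mono oadd_omega_pow_twice_less, rule Cut.hyps(4))+
  have IH1: "deriv (Th \<eta>') (relativize (Hull \<eta>') X) (Th \<eta>') (\<Gamma> \<union> {\<psi>})" if "Sigma_sentence \<psi>"
    unfolding \<eta>'_def
    by (rule Cut.IH(1)[OF Cut.prems(1-3)])
      (use Cut.prems(4-6) par that in \<open>simp add: Sigma_sequent_def; blast\<close>)+
  have IH2: "deriv (Th \<eta>') (relativize (Hull \<eta>') X) (Th \<eta>') (\<Gamma> \<union> {neg \<psi>})"
    if "Sigma_sentence (neg \<psi>)"
    unfolding \<eta>'_def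
    by (rule Cut.IH(2)[OF Cut.prems(1-3)])
      (use Cut.prems(4-6) par that in \<open>simp add: Sigma_sequent_def; blast\<close>)+
  have weak: "deriv (Th \<eta>) (relativize (Hull \<eta>) X) (Th \<eta>') \<Xi>"
    if "deriv (Th \<eta>') (relativize (Hull \<eta>') X) (Th \<eta>') \<Xi>" for \<Xi>
    using that by (rule deriv_relativize_Hull_mono) (use less(1) \<eta>'(1) in \<open>auto simp: oleq_def\<close>)
  show ?case
  proof (cases "Om \<in> params \<psi>")
    case False
    \<comment> \<open>Without stage \<open>Om\<close>, both \<open>\<psi>\<close> and its negation
      are Sigma sentences, so both premises collapse to the common height
      \<open>Th \<eta>'\<close>.\<close>
    then have "stage P \<noteq> Om" if "P \<in> set_fm \<psi>" for P
      using that by (metis image_eqI params_def)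
    then have pre: "Sigma_sentence \<psi>" "Sigma_sentence (neg \<psi>)"
      using neg_preds_subset[of \<psi>] neg_preds_neg_subset[of \<psi>] Cut.hyps(2) by auto
    have "s \<prec> Th \<eta>" if "s \<in> params \<psi>" for s
    proof (rule C_set_Th_below_Om)
      show "s \<in> C_set \<eta> (Th \<eta>)"
        using Hull_subset_C_set[OF \<open>\<alpha> \<prec> \<eta>\<close> Cut.prems(3)[rule_format, OF \<open>\<alpha> \<prec> \<eta>\<close>]] par(1) that
        by auto
      show "s \<prec> Om"
        using Cut.hyps(2) that False
        by (metis imageE oleq_def params_def sentence_def)
    qed
    then have rk: "rk \<psi> \<prec> Th \<eta>" by (simp add: rk_less_Th)
    show ?thesis
      unfolding \<eta>_def[symmetric]
      using deriv.Cut[where H = "relativize (Hull \<eta>) X", OF ctrl Cut.hyps(2) rk less(1)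
          weak[OF IH1[OF pre(1)]] weak[OF IH2[OF pre(2)]]] .
  next
    case True
    \<comment> \<open>The rank is below \<open>Om \<oplus> onum 1\<close> and at least
      \<open>Om\<close>.\<close>
    then have "rk \<psi> = Om"
      using Om_le_rk Cut.hyps(3) oless_oadd_one_iff by (auto intro: oterm.order.antisym)
    then obtain \<phi> t where lit: "\<psi> = Pos (Ilt \<phi> Om) t \<or> \<psi> = Neg (Ilt \<phi> Om) t"
      by (rule rk_eq_Om)
    \<comment> \<open>The new stage is the height of the collapsed premise containing
      \<open>?p\<close>, so \<open>deriv_bound\<close> turns \<open>?p\<close> into
      \<open>?q\<close>.\<close>
    let ?p = "Pos (Ilt \<phi> Om) t" and ?q = "Pos (Ilt \<phi> (Th \<eta>')) t"
    have form: "operator_form \<phi>" "free_tm t = {}"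
      using lit Cut.hyps(2) by (auto simp: sentence_def)
    have der: "deriv (Th \<eta>') (relativize (Hull \<eta>') X) (Th \<eta>') (\<Gamma> \<union> {?p})"
      using lit
    proof
      assume "\<psi> = ?p"
      then show ?thesis using IH1 Cut.hyps(2) by simp
    next
      assume "\<psi> = Neg (Ilt \<phi> Om) t"
      then show ?thesis using IH2 Cut.hyps(2) by (simp add: sentence_def)
    qed
    have "\<alpha> \<prec> \<eta>'" using oless_oadd_omega_pow by (simp add: \<eta>'_def)
    then have sub'': "Hull \<alpha> X \<subseteq> Hull \<eta>' X" by (intro Hull_mono) (auto simp: oleq_def)
    have Th': "Th \<eta>' \<in> Hull \<eta>' X"
      unfolding \<eta>'_def by (rule Th_collapse_in_Hull[OF Cut.prems(2) \<beta>'])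
    from der have 1: "deriv (Th \<eta>') (relativize (Hull \<eta>') X) (Th \<eta>') (\<Gamma> \<union> {?q})"
      by (rule deriv_bound[where \<beta> = "Th \<eta>'", OF _ mono_relativize_Hull])
        (use Cut.prems(5) sub'' Th' in \<open>auto simp: relativize_def oless_simps(4) params_def\<close>)
    \<comment> \<open>The other premise is collapsed from \<open>\<eta>'\<close> in place of
      \<open>\<alpha>\<close>, because \<open>neg ?q\<close> has the parameter
      \<open>Th \<eta>'\<close>, controlled by \<open>Hull \<eta>' X\<close>.\<close>
    have \<eta>'_in: "\<eta>' \<in> Hull \<eta>' X"
      using oadd_omega_pow_in_Hull[OF Cut.prems(2) \<beta>'] sub'' by (auto simp: \<eta>'_def)
    have le: "H \<le> relativize (Hull \<eta>') X"
      using Cut.prems(1) Hull_mono[of \<alpha> \<eta>'] \<open>\<alpha> \<prec> \<eta>'\<close>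
      by (fastforce simp: le_fun_def relativize_def oleq_def)
    have C: "\<forall>\<xi>. \<eta>' \<prec> \<xi> \<longrightarrow> X \<subseteq> C_set \<xi> (Th \<xi>)"
      using Cut.prems(3) \<open>\<alpha> \<prec> \<eta>'\<close> by (meson oterm.order.strict_trans)
    have Sigma: "Sigma_sequent (\<Gamma> \<union> {neg ?q})"
      using Cut.prems(4) form
      by (auto simp: Sigma_sequent_def sentence_def oleq_def oless_simps(4) oterm_distinct(1)[symmetric])
    have par': "\<Union>(params ` (\<Gamma> \<union> {neg ?q})) \<subseteq> Hull \<eta>' X"
      using Cut.prems(5) sub'' Th' by (auto simp: params_def)
    let ?\<zeta> = "\<eta>' \<oplus> omega_pow \<beta>'"
    \<comment> \<open>The given premise contains \<open>neg ?p\<close>, which is not a Sigma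
      sentence; the relation between \<open>\<Delta>\<close> and \<open>\<Gamma>\<close> permits
      \<open>neg ?q\<close> instead.\<close>
    have 2: "deriv (Th ?\<zeta>) (relativize (Hull ?\<zeta>) X) (Th ?\<zeta>) (\<Gamma> \<union> {neg ?q})"
      using lit
    proof
      assume "\<psi> = ?p"
      then show ?thesis
        by (intro Cut.IH(2)[OF le \<eta>'_in C Sigma par']) (use Cut.prems(6) in auto)
    next
      assume "\<psi> = Neg (Ilt \<phi> Om) t"
      then show ?thesis
        by (intro Cut.IH(1)[OF le \<eta>'_in C Sigma par']) (use Cut.prems(6) in auto)
    qed
    have "\<beta>' \<in> Hull \<eta>' X" using \<beta>' sub'' by blast
    then have Th\<zeta>: "Th ?\<zeta> \<in> Hull \<eta> X"
      using Th_collapse_in_Hull[OF \<eta>'_in] Hull_mono[of ?\<zeta> \<eta> X X] \<eta>'(2) by (auto simp: oleq_def)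
    have "\<eta>' \<prec> ?\<zeta>" by (rule oless_oadd_omega_pow)
    then have "Th \<eta>' \<prec> Th ?\<zeta>"
      using \<eta>'_in C Hull_subset_C_set by (blast intro: Th_less_Th_if_C_set)
    \<comment> \<open>Cut requires equal heights, so the first premise is raised from
      \<open>Th \<eta>'\<close> to \<open>Th ?\<zeta>\<close>.\<close>
    from weak[OF 1] have "deriv (Th \<eta>) (relativize (Hull \<eta>) X) (Th ?\<zeta>) (\<Gamma> \<union> {?q})"
      by (rule deriv_height_mono) (use Th\<zeta> \<open>Th \<eta>' \<prec> Th ?\<zeta>\<close> in \<open>auto simp: relativize_def oleq_def\<close>)
    moreover have "deriv (Th \<eta>) (relativize (Hull \<eta>) X) (Th ?\<zeta>) (\<Gamma> \<union> {neg ?q})"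
      using 2 less(2) \<eta>'(2) by (meson deriv_relativize_Hull_mono oterm.order.strict_implies_order)
    moreover have "sentence ?q"
      using form by (simp add: sentence_def oleq_def oless_simps(4))
    moreover have "rk ?q \<prec> Th \<eta>"
      using less(1) by (simp add: omega_times_less_Th)
    ultimately show ?thesis
      unfolding \<eta>_def[symmetric]
      using deriv.Cut[where H = "relativize (Hull \<eta>) X", OF ctrl] less(2) by blast
  qed
next
  case (Fix \<beta> \<Delta> H \<phi> t \<beta>')
  define \<eta> where "\<eta> = \<alpha> \<oplus> omega_pow \<beta>"
  define \<eta>' where "\<eta>' = \<alpha> \<oplus> omega_pow \<beta>'"
  have sub: "H {} \<subseteq> Hull \<alpha> X"
    using le_funD[OF Fix.prems(1), of "{}"] by (auto simp: relativize_def)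
  have \<beta>: "\<beta> \<in> Hull \<alpha> X" using sub Fix.hyps(1) by auto
  have "\<alpha> \<prec> \<eta>" using oless_oadd_omega_pow[of \<alpha> \<beta>] by (simp add: \<eta>_def)
  then have sub': "Hull \<alpha> X \<subseteq> Hull \<eta> X" by (intro Hull_mono) (auto simp: oleq_def)
  have ctrl: "insert (Th \<eta>) (\<Union>(params ` \<Gamma>)) \<subseteq> relativize (Hull \<eta>) X {}"
    using Th_collapse_in_Hull[OF Fix.prems(2) \<beta>(1)] Fix.prems(5) sub'
    by (auto simp: relativize_def \<eta>_def)
  have ctrl': "insert \<beta>' (params (unfold_form \<phi> t Om)) \<subseteq> Hull \<alpha> X"
    using deriv_controlled[OF Fix.hyps(5)] sub by auto
  have less: "Th \<eta>' \<prec> Th \<eta>"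
    unfolding \<eta>_def \<eta>'_def
    using Fix.prems Fix.hyps(4) ctrl' by (intro Th_collapse_less[of _ X]) auto
  have \<eta>': "\<eta>' \<prec> \<eta>"
    using oadd_omega_pow_strict_mono[OF Fix.hyps(4)] by (simp add: \<eta>_def \<eta>'_def)
  have mem: "Pos (Ilt \<phi> Om) t \<in> \<Gamma>" using Fix.hyps(3) Fix.prems(6) by auto
  then have form: "operator_form \<phi>" "free_tm t = {}"
    using Fix.prems(4) by (auto simp: Sigma_sequent_def sentence_def)
  have der: "deriv (Th \<eta>') (relativize (Hull \<eta>') X) (Th \<eta>') (\<Gamma> \<union> {unfold_form \<phi> t Om})"
    unfolding \<eta>'_def
  proof (rule Fix.IH[OF Fix.prems(1-3)])
    show "Sigma_sequent (\<Gamma> \<union> {unfold_form \<phi> t Om})"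
      using Fix.prems(4) sentence_unfold_form[OF form] neg_preds_unfold_form[OF form(1)]
      by (auto simp: Sigma_sequent_def)
  qed (use Fix.prems ctrl' in auto)
  have "\<alpha> \<prec> \<eta>'" using oless_oadd_omega_pow by (simp add: \<eta>'_def)
  then have sub'': "Hull \<alpha> X \<subseteq> Hull \<eta>' X" by (intro Hull_mono) (auto simp: oleq_def)
  have Th': "Th \<eta>' \<in> Hull \<eta>' X"
    unfolding \<eta>'_def using ctrl' by (intro Th_collapse_in_Hull[OF Fix.prems(2)]) auto
  have par: "params (unfold_form \<phi> t (Th \<eta>')) \<subseteq> {Th \<eta>'}"
    using set_fm_unfold_form[of \<phi> t "Th \<eta>'"] by (auto simp: params_def)
  from der have "deriv (Th \<eta>') (relativize (Hull \<eta>') X) (Th \<eta>')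
      (\<Gamma> \<union> {unfold_form \<phi> t (Th \<eta>')})"
    by (rule deriv_bound[where \<beta> = "Th \<eta>'", OF _ mono_relativize_Hull])
      (use Fix.prems(5) sub'' Th' par in
        \<open>auto simp: relativize_def oless_simps(4) bound_unfold_form[OF form(1)]\<close>)
  then have "deriv (Th \<eta>) (relativize (Hull \<eta>) X) (Th \<eta>') (\<Gamma> \<union> {unfold_form \<phi> t (Th \<eta>')})"
    using less \<eta>' by (meson deriv_relativize_Hull_mono oterm.order.strict_implies_order)
  \<comment> \<open>\<open>Th \<eta>'\<close> serves both as height of the premise and as witness:
    it lies below \<open>Om\<close> and below \<open>Th \<eta>\<close>.\<close>
  moreover have "disj_of (Pos (Ilt \<phi> Om) t) Om (unfold_form \<phi> t)"
    by (auto intro: disj_of.intros)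
  moreover have "Th \<eta>' \<in> relativize (Hull \<eta>) X {}"
    using Th' Hull_mono[of \<eta>' \<eta> X X] \<eta>' by (auto simp: relativize_def oleq_def)
  ultimately show ?case
    unfolding \<eta>_def[symmetric]
    using deriv.Disj[where H = "relativize (Hull \<eta>) X", OF ctrl mem] less oless_simps(4) by blast
qed

theorem theorem6p7:
  fixes \<Gamma> :: "pred fm set" and \<alpha> \<beta> \<eta> :: oterm and X :: "oterm set"
  assumes "Sigma_sequent \<Gamma>"
    and "\<alpha> \<in> Hull \<alpha> X"
    and "X \<subseteq> \<Inter>{C_set \<xi> (Th \<xi>) |\<xi>. \<alpha> \<prec> \<xi>}"
    and "relativize (Hull \<alpha>) X \<turnstile>[\<beta>, Om \<oplus> onum 1] \<Gamma>"
    and "\<eta> = \<alpha> \<oplus> omega_pow \<beta>"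
  shows "relativize (Hull \<eta>) X \<turnstile>[Th \<eta>, Th \<eta>] \<Gamma>"
  unfolding assms(5)
\<comment> \<open>Applied with \<open>\<Delta> = \<Gamma>\<close> and the operator itself; the
  parameters of \<open>\<Gamma>\<close> are controlled since the given derivation is.\<close>
proof (rule collapsing[OF assms(4) order.refl assms(2)])
  show "\<Union>(params ` \<Gamma>) \<subseteq> Hull \<alpha> X"
    using deriv_controlled[OF assms(4)] by (simp add: relativize_def)
qed (use assms in auto)

end
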